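(* Let $X$ be a separable infinite dimensional Banach space over $\mathbb{K}$ and let $T:X\to X$ be a bounded linear operator. Assume that there is a dense linear subspace $F$ of $X$ with $T(F)\subseteq F$ such that: (B1) $F$ carries an inner product $\langle\cdot,\cdot\rangle$ such that the topology on $F$ defined by the norm $\|x\|_0=\sqrt{\langle x,x\rangle}$ is (not necessarily strictly) stronger than the topology that $F$ inherits from the norm of $X$; (B2) the continuous extension of the restriction $S=T|_F:F\to F$ to the Hilbert space completion of the normed space $(F,\|\cdot\|_0)$ is an isometry having no non-trivial finite dimensional invariant subspaces; (B3) every $x\in F$ has a backward $T$-orbit which converges to $0$ in the norm of $X$. Then $T$ is weakly hypercyclic.
   Context: $\mathbb{K}$ denotes either $\mathbb{R}$ or $\mathbb{C}$. For $x\in X$, the orbit is $O(T,x)=\{T^nx:n\in\mathbb{Z}_+\}$ ($\mathbb{Z}_+=\{0,1,2,\dots\}$). $T$ is weakly hypercyclic if there is $x\in X$ whose orbit $O(T,x)$ is dense in $X$ with respect to the weak topology of $X$. A backward $T$-orbit of $x$ is a sequence $\{x_n\}_{n\in\mathbb{Z}_+}$ in $X$ with $x_0=x$ and $Tx_{n+1}=x_n$ for every $n\in\mathbb{Z}_+$. *)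

theory Defs
  imports "HOL-Analysis.Analysis"
begin

text \<open>Scalar field K: K = complex numbers if cplx, K = reals (as a subset of the
complex numbers) otherwise.  A K-vector space is modelled as a real vector space
together with (in the complex case) a complex structure J, i.e. i*x = J x.\<close>

definition Kscalars :: "bool \<Rightarrow> complex set" where
  "Kscalars cplx = (if cplx then UNIV else \<real>)"

definition scal :: "('a::real_vector \<Rightarrow> 'a) \<Rightarrow> complex \<Rightarrow> 'a \<Rightarrow> 'a" where
  "scal J c x = Re c *\<^sub>R x + Im c *\<^sub>R J x"

definition K_normed_space :: "bool \<Rightarrow> ('a::real_normed_vector \<Rightarrow> 'a) \<Rightarrow> bool" where
  "K_normed_space cplx J \<longleftrightarrow>
     (cplx \<longrightarrow> linear J \<and> (\<forall>x. J (J x) = - x) \<and>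
                (\<forall>c x. norm (scal J c x) = cmod c * norm x))"

definition K_subspace :: "bool \<Rightarrow> ('a::real_vector \<Rightarrow> 'a) \<Rightarrow> 'a set \<Rightarrow> bool" where
  "K_subspace cplx J F \<longleftrightarrow> subspace F \<and> (cplx \<longrightarrow> J ` F \<subseteq> F)"

definition K_span :: "bool \<Rightarrow> ('a::real_vector \<Rightarrow> 'a) \<Rightarrow> 'a set \<Rightarrow> 'a set" where
  "K_span cplx J B = span (if cplx then B \<union> J ` B else B)"

definition K_infinite_dimensional :: "bool \<Rightarrow> ('a::real_vector \<Rightarrow> 'a) \<Rightarrow> bool" where
  "K_infinite_dimensional cplx J \<longleftrightarrow> (\<forall>B. finite B \<longrightarrow> K_span cplx J B \<noteq> UNIV)"

definition K_linear :: "bool \<Rightarrow> ('a::real_vector \<Rightarrow> 'a) \<Rightarrow> ('a \<Rightarrow> 'a) \<Rightarrow> bool" where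
  "K_linear cplx J T \<longleftrightarrow> linear T \<and> (cplx \<longrightarrow> (\<forall>x. T (J x) = J (T x)))"

definition K_inner_product ::
  "bool \<Rightarrow> ('a::real_vector \<Rightarrow> 'a) \<Rightarrow> 'a set \<Rightarrow> ('a \<Rightarrow> 'a \<Rightarrow> complex) \<Rightarrow> bool" where
  "K_inner_product cplx J S ip \<longleftrightarrow>
     (\<forall>x\<in>S. \<forall>y\<in>S. ip x y \<in> Kscalars cplx) \<and>
     (\<forall>x\<in>S. \<forall>y\<in>S. ip y x = cnj (ip x y)) \<and>
     (\<forall>x\<in>S. \<forall>y\<in>S. \<forall>z\<in>S. ip (x + y) z = ip x z + ip y z) \<and>
     (\<forall>c\<in>Kscalars cplx. \<forall>x\<in>S. \<forall>y\<in>S. ip (scal J c x) y = c * ip x y) \<and>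
     (\<forall>x\<in>S. 0 \<le> Re (ip x x)) \<and>
     (\<forall>x\<in>S. ip x x = 0 \<longrightarrow> x = 0)"

definition ip_norm :: "('a \<Rightarrow> 'a \<Rightarrow> complex) \<Rightarrow> 'a \<Rightarrow> real" where
  "ip_norm ip x = sqrt (Re (ip x x))"

definition K_functional :: "bool \<Rightarrow> ('a::real_normed_vector \<Rightarrow> 'a) \<Rightarrow> ('a \<Rightarrow> complex) \<Rightarrow> bool" where
  "K_functional cplx J f \<longleftrightarrow>
     (\<forall>x y. f (x + y) = f x + f y) \<and>
     (\<forall>c\<in>Kscalars cplx. \<forall>x. f (scal J c x) = c * f x) \<and>
     (\<forall>x. f x \<in> Kscalars cplx) \<and>
     (\<exists>B. \<forall>x. cmod (f x) \<le> B * norm x)"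

definition weakly_dense :: "bool \<Rightarrow> ('a::real_normed_vector \<Rightarrow> 'a) \<Rightarrow> 'a set \<Rightarrow> bool" where
  "weakly_dense cplx J A \<longleftrightarrow>
     (\<forall>x0 \<Phi> e. finite \<Phi> \<and> (\<forall>f\<in>\<Phi>. K_functional cplx J f) \<and> e > 0 \<longrightarrow>
        (\<exists>a\<in>A. \<forall>f\<in>\<Phi>. cmod (f a - f x0) < e))"

definition orbit :: "('a \<Rightarrow> 'a) \<Rightarrow> 'a \<Rightarrow> 'a set" where
  "orbit T x = {(T ^^ n) x | n. True}"

definition weakly_hypercyclic :: "bool \<Rightarrow> ('a::real_normed_vector \<Rightarrow> 'a) \<Rightarrow> ('a \<Rightarrow> 'a) \<Rightarrow> bool" where
  "weakly_hypercyclic cplx J T \<longleftrightarrow> (\<exists>x. weakly_dense cplx J (orbit T x))"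

definition backward_orbit :: "('a \<Rightarrow> 'a) \<Rightarrow> 'a \<Rightarrow> (nat \<Rightarrow> 'a) \<Rightarrow> bool" where
  "backward_orbit T x xs \<longleftrightarrow> xs 0 = x \<and> (\<forall>n. T (xs (Suc n)) = xs n)"

definition hilbert_completion ::
  "bool \<Rightarrow> ('a::real_vector \<Rightarrow> 'a) \<Rightarrow> 'a set \<Rightarrow> ('a \<Rightarrow> 'a \<Rightarrow> complex) \<Rightarrow>
   ('h::banach \<Rightarrow> 'h) \<Rightarrow> ('h \<Rightarrow> 'h \<Rightarrow> complex) \<Rightarrow> ('a \<Rightarrow> 'h) \<Rightarrow> bool" where
  "hilbert_completion cplx J F ip JH ipH \<iota> \<longleftrightarrow>
     K_normed_space cplx JH \<and>
     K_inner_product cplx JH UNIV ipH \<and>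
     (\<forall>h. norm h = ip_norm ipH h) \<and>
     (\<forall>x\<in>F. \<forall>y\<in>F. \<iota> (x + y) = \<iota> x + \<iota> y) \<and>
     (\<forall>c\<in>Kscalars cplx. \<forall>x\<in>F. \<iota> (scal J c x) = scal JH c (\<iota> x)) \<and>
     (\<forall>x\<in>F. \<forall>y\<in>F. ipH (\<iota> x) (\<iota> y) = ip x y) \<and>
     closure (\<iota> ` F) = UNIV"

end

theory Submission
  imports Defs "HOL-Complex_Analysis.Great_Picard"
begin

text \<open>
  An isometry \<open>V\<close> of a Hilbert space without finite dimensional invariant subspaces is weakly mixing:
  if the numbers \<open>\<langle>V\<^sup>p w, g\<rangle>\<close>, for \<open>g\<close> in a finite set, were never simultaneously small, then the
  Hilbert-Schmidt minimiser over the convex combinations of the rank-one operators \<open>V\<^sup>p w \<otimes> V\<^sup>p w\<close>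
  would be a nonzero positive trace class operator commuting with \<open>V\<close>, and its top eigenspace would be a
  finite dimensional invariant subspace.

  Let \<open>y\<^sub>k\<close> run through a dense subset of \<open>F\<close> and let \<open>x\<close> be the sum over \<open>k\<close> of the \<open>n\<^sub>k\<close>-th entries of
  backward orbits of the \<open>y\<^sub>k\<close>.  If \<open>n\<^sub>k\<close> grows fast, then up to a small error the \<open>n\<^sub>k\<close>-th iterate of
  \<open>x\<close> is \<open>y\<^sub>k + z\<^sub>k\<close>, where \<open>z\<^sub>k\<close> is the sum of the \<open>(n\<^sub>k - n\<^sub>l)\<close>-th iterates of \<open>y\<^sub>l\<close> over \<open>l < k\<close>.  By weak
  mixing the \<open>z\<^sub>k\<close> can be made almost orthogonal, and their squared norms then grow only linearly provided
  vectors \<open>y\<^sub>k\<close> of large norm occur rarely.  Along any set of indices of positive density the reciprocals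
  of the squared norms have a divergent sum, so by Bessel's inequality \<open>0\<close> is in the weak closure of the
  corresponding \<open>z\<^sub>k\<close>; this applies to the indices at which a given target is used.

  Everything takes place over the reals, with the inner product \<open>Re \<langle>\<cdot>, \<cdot>\<rangle>\<close>: a real invariant subspace
  spans a complex one, and weak convergence is tested on real and imaginary parts.
\<close>

section \<open>Cauchy-Schwarz for semidefinite forms, and convergence at rate 1/(n+1)\<close>

text \<open>The quadratic polynomial t \<mapsto>
  \<open>\<beta> (x + t *\<^sub>R y) (x + t *\<^sub>R y)\<close> is nonnegative. Definiteness is not
  assumed because the inequality is applied both to the inner product and to the form
  \<open>b (A x) y\<close> of a positive operator.\<close>

lemma psd_form_Cauchy_Schwarz:
  fixes \<beta> :: "'v::real_vector \<Rightarrow> 'v \<Rightarrow> real"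
  assumes add: "\<And>x y z. \<beta> (x + y) z = \<beta> x z + \<beta> y z"
    and scale: "\<And>r x y. \<beta> (r *\<^sub>R x) y = r * \<beta> x y"
    and sym: "\<And>x y. \<beta> x y = \<beta> y x"
    and nonneg: "\<And>x. 0 \<le> \<beta> x x"
  shows "(\<beta> x y)\<^sup>2 \<le> \<beta> x x * \<beta> y y"
proof -
  have add': "\<beta> z (x + y) = \<beta> z x + \<beta> z y" for x y z
    using add[of x y z] by (simp only: sym[of z])
  have scale': "\<beta> x (r *\<^sub>R y) = r * \<beta> x y" for r x y
    using scale[of r y x] by (simp only: sym[of x])
  have quad: "0 \<le> \<beta> x x + 2 * t * \<beta> x y + t\<^sup>2 * \<beta> y y" for t
  proof -
    have "\<beta> (x + t *\<^sub>R y) (x + t *\<^sub>R y) = \<beta> x x + 2 * t * \<beta> x y + t\<^sup>2 * \<beta> y y"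
      by (simp add: add scale add' scale' sym[of y x] algebra_simps power2_eq_square)
    then show ?thesis using nonneg[of "x + t *\<^sub>R y"] by simp
  qed
  show ?thesis
  proof (cases "\<beta> y y = 0")
    case True
    have "\<beta> x y = 0"
    proof (rule ccontr)
      assume nz: "\<beta> x y \<noteq> 0"
      \<comment> \<open>With \<open>\<beta> y y = 0\<close> the polynomial is affine in t, and this
        t gives it the value -1.\<close>
      have "2 * (- (\<beta> x x + 1) / (2 * \<beta> x y)) * \<beta> x y = - (\<beta> x x + 1)"
        using nz by simp
      then show False
        using quad[of "- (\<beta> x x + 1) / (2 * \<beta> x y)"] True by simp
    qed
    then show ?thesis using True by simp
  next
    case False
    then have pos: "\<beta> y y > 0" using nonneg[of y] by simp
    have "\<beta> x x + 2 * (- \<beta> x y / \<beta> y y) * \<beta> x y + (- \<beta> x y / \<beta> y y)\<^sup>2 * \<beta> y y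
        = \<beta> x x - (\<beta> x y)\<^sup>2 / \<beta> y y"
      using pos by (simp add: field_simps power2_eq_square)
    then have "(\<beta> x y)\<^sup>2 / \<beta> y y \<le> \<beta> x x"
      using quad[of "- \<beta> x y / \<beta> y y"] by simp
    then show ?thesis using pos by (simp add: field_simps)
  qed
qed

lemma inverse_Suc_times_tendsto_0: "(\<lambda>n. inverse (real (Suc n)) * c) \<longlonglongrightarrow> 0"
  using tendsto_mult[OF LIMSEQ_inverse_real_of_nat tendsto_const, of c] by simp

lemma tendsto_of_inverse_Suc_bound:
  fixes l :: "'v::real_normed_vector"
  assumes "\<And>n. norm (f n - l) \<le> inverse (real (Suc n)) * c"
  shows "f \<longlonglongrightarrow> l"
proof -
  have "(\<lambda>n. f n - l) \<longlonglongrightarrow> 0"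
    by (rule Lim_null_comparison[OF _ inverse_Suc_times_tendsto_0[of c]]) (use assms in auto)
  then show ?thesis by (simp add: LIM_zero_iff)
qed

section \<open>Real inner products and finite orthonormal systems\<close>

text \<open>The type carries only the norm and its completeness, so the inner product is a parameter
  tied to the norm by \<open>b_norm\<close>. It will be the real part of a possibly complex inner
  product.\<close>

locale real_hilbert_form =
  fixes b :: "'h::banach \<Rightarrow> 'h \<Rightarrow> real"
  assumes b_add: "b (x + y) z = b x z + b y z"
    and b_scale: "b (r *\<^sub>R x) y = r * b x y"
    and b_sym: "b x y = b y x"
    and b_norm: "b x x = (norm x)\<^sup>2"
begin

lemma b_bound: "\<bar>b x y\<bar> \<le> norm x * norm y"
proof -
  have "(b x y)\<^sup>2 \<le> (norm x * norm y)\<^sup>2"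
    using psd_form_Cauchy_Schwarz[of b x y, OF b_add b_scale b_sym]
    by (simp add: b_norm power_mult_distrib)
  then show ?thesis by (simp add: abs_le_square_iff[symmetric] abs_mult)
qed

sublocale b: bounded_bilinear b
  apply unfold_locales
      apply (simp add: b_add)
     apply (metis b_add b_sym)
    apply (simp add: b_scale)
   apply (metis b_scale b_sym real_scaleR_def)
  using b_bound by (metis mult.right_neutral real_norm_def)

definition orthonormal :: "'h set \<Rightarrow> bool" where
  "orthonormal E \<longleftrightarrow> finite E \<and> (\<forall>e\<in>E. \<forall>f\<in>E. b e f = (if e = f then 1 else 0))"

lemma orthonormal_coeff:
  assumes "orthonormal E" "e \<in> E"
  shows "b (\<Sum>f\<in>E. c f *\<^sub>R f) e = c e"
proof -
  have "b (\<Sum>f\<in>E. c f *\<^sub>R f) e = (\<Sum>f\<in>E. if f = e then c e else 0)"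
    unfolding b.sum_left b.scaleR_left
    using assms by (intro sum.cong) (auto simp: orthonormal_def)
  then show ?thesis using assms by (simp add: orthonormal_def)
qed

lemma orthonormal_norm_sum:
  assumes "orthonormal E"
  shows "(norm (\<Sum>f\<in>E. c f *\<^sub>R f))\<^sup>2 = (\<Sum>f\<in>E. (c f)\<^sup>2)"
proof -
  let ?s = "\<Sum>f\<in>E. c f *\<^sub>R f"
  have "b ?s ?s = (\<Sum>f\<in>E. c f * b ?s f)"
    by (rule trans[OF b.sum_right]) (simp add: b.scaleR_right)
  also have "\<dots> = (\<Sum>f\<in>E. (c f)\<^sup>2)"
    by (intro sum.cong) (auto simp: orthonormal_coeff[OF assms] power2_eq_square)
  finally show ?thesis by (simp add: b_norm)
qed

lemma bessel:
  assumes "orthonormal E"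
  shows "(\<Sum>e\<in>E. (b x e)\<^sup>2) \<le> (norm x)\<^sup>2"
proof -
  let ?s = "\<Sum>e\<in>E. b x e *\<^sub>R e"
  have xs: "b x ?s = (\<Sum>e\<in>E. (b x e)\<^sup>2)"
    by (simp add: b.sum_right b.scaleR_right power2_eq_square)
  have ss: "b ?s ?s = (\<Sum>e\<in>E. (b x e)\<^sup>2)"
    using orthonormal_norm_sum[OF assms, of "b x"] by (simp add: b_norm)
  have "0 \<le> b (x - ?s) (x - ?s)" by (simp add: b_norm)
  also have "\<dots> = (norm x)\<^sup>2 - (\<Sum>e\<in>E. (b x e)\<^sup>2)"
    unfolding b.diff_left b.diff_right b_sym[of ?s x] xs ss by (simp add: b_norm)
  finally show ?thesis by simp
qed

text \<open>One Gram-Schmidt step. It serves to enlarge orthonormal systems and, in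
  \<open>weak_mixing\<close>, to contradict the maximality of one.\<close>

lemma orthonormal_insert:
  assumes E: "orthonormal E" and r: "r = x - (\<Sum>e\<in>E. b x e *\<^sub>R e)" "r \<noteq> 0"
  shows "orthonormal (insert (r /\<^sub>R norm r) E)" "r /\<^sub>R norm r \<notin> E"
proof -
  let ?n = "r /\<^sub>R norm r"
  have o: "b r e = 0" if "e \<in> E" for e
    using that by (simp add: r b.diff_left orthonormal_coeff[OF E])
  have n1: "b ?n ?n = 1" using r by (simp add: b_norm)
  have o': "b ?n e = 0" "b e ?n = 0" if "e \<in> E" for e
    using o[OF that] by (simp_all add: b.scaleR_left b.scaleR_right b_sym[of e])
  show nin: "?n \<notin> E" using n1 o' by force
  show "orthonormal (insert ?n E)"
    using E n1 o' nin unfolding orthonormal_def by auto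
qed

text \<open>Gram-Schmidt, one vector of \<open>U\<close> at a time. The vectors already expanded
  keep their expansion, being orthogonal to the new unit vector.\<close>

lemma orthonormal_extend:
  assumes "orthonormal E" "finite U"
  shows "\<exists>E'. orthonormal E' \<and> E \<subseteq> E' \<and> (\<forall>u\<in>U. u = (\<Sum>e\<in>E'. b u e *\<^sub>R e))"
  using assms(2)
proof (induction U)
  case empty
  then show ?case using assms(1) by auto
next
  case (insert x U)
  then obtain E' where E': "orthonormal E'" "E \<subseteq> E'"
    and U: "\<And>u. u \<in> U \<Longrightarrow> u = (\<Sum>e\<in>E'. b u e *\<^sub>R e)" by blast
  have fin: "finite E'" using E' by (simp add: orthonormal_def)
  define r where "r = x - (\<Sum>e\<in>E'. b x e *\<^sub>R e)"
  show ?case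
  proof (cases "r = 0")
    case True
    then have "x = (\<Sum>e\<in>E'. b x e *\<^sub>R e)" by (simp add: r_def)
    then show ?thesis using E' U by (intro exI[of _ E']) auto
  next
    case False
    let ?n = "r /\<^sub>R norm r"
    note ins = orthonormal_insert[OF E'(1) r_def False]
    have on: "b e ?n = 0" if "e \<in> E'" for e
      using ins that unfolding orthonormal_def by force
    have Un: "b u ?n = 0" if "u \<in> U" for u
      by (subst U[OF that]) (simp add: b.sum_left b.scaleR_left on)
    have "b r ?n = norm r"
      using False by (simp add: b.scaleR_right b_norm power2_eq_square)
    moreover have "b (\<Sum>e\<in>E'. b x e *\<^sub>R e) ?n = 0"
      unfolding b.sum_left b.scaleR_left by (intro sum.neutral) (simp add: on)
    ultimately have "b x ?n = norm r" by (simp add: r_def b.diff_left)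
    then have "b x ?n *\<^sub>R ?n = r" using False by simp
    then have x: "x = (\<Sum>e\<in>insert ?n E'. b x e *\<^sub>R e)"
      using ins(2) fin by (simp add: r_def)
    have "u = (\<Sum>e\<in>insert ?n E'. b u e *\<^sub>R e)" if "u \<in> U" for u
    proof -
      have "(\<Sum>e\<in>insert ?n E'. b u e *\<^sub>R e) = (\<Sum>e\<in>E'. b u e *\<^sub>R e)"
        using ins(2) fin Un[OF that] by simp
      then show ?thesis using U[OF that] by (rule trans[rotated, OF sym])
    qed
    then show ?thesis using x ins(1) E'(2)
      by (intro exI[of _ "insert ?n E'"]) (auto simp del: sum.insert)
  qed
qed

subsection \<open>Combinations of rank-one operators\<close>

definition rank_one_sum :: "(nat \<Rightarrow> 'h) \<Rightarrow> nat \<Rightarrow> (nat \<Rightarrow> real) \<Rightarrow> 'h \<Rightarrow> 'h" where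
  "rank_one_sum u k a h = (\<Sum>p<k. (a p * b h (u p)) *\<^sub>R u p)"

text \<open>The squared Hilbert-Schmidt norm of \<open>rank_one_sum u k a\<close>, because the
  Hilbert-Schmidt inner product of the operators \<open>u p \<otimes> u p\<close> and
  \<open>u q \<otimes> u q\<close> is \<open>(b (u p) (u q))\<^sup>2\<close>. As a quadratic form in
  the coefficients it requires no space of operators.\<close>

definition hs_norm2 :: "(nat \<Rightarrow> 'h) \<Rightarrow> nat \<Rightarrow> (nat \<Rightarrow> real) \<Rightarrow> real" where
  "hs_norm2 u k a = (\<Sum>p<k. \<Sum>q<k. a p * a q * (b (u p) (u q))\<^sup>2)"

text \<open>The operator norm is at most the Hilbert-Schmidt norm: in an orthonormal system
  containing the direction of \<open>h\<close> and spanning all \<open>u p\<close>, the right side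
  sums the squares of all matrix entries and the left side those of one row. The coefficients may
  have any sign, since differences of convex combinations are to be estimated.\<close>

lemma hs_norm2_bound: "(norm (rank_one_sum u k a h))\<^sup>2 \<le> hs_norm2 u k a * (norm h)\<^sup>2"
proof (cases "h = 0")
  case True
  then show ?thesis by (simp add: rank_one_sum_def b.zero_left)
next
  case False
  define e0 where "e0 = h /\<^sub>R norm h"
  have "orthonormal {e0}" using False by (simp add: orthonormal_def e0_def b_norm)
  from orthonormal_extend[OF this, of "u ` {..<k}"]
  obtain E where E: "orthonormal E" "e0 \<in> E"
    and U: "\<And>p. p < k \<Longrightarrow> u p = (\<Sum>e\<in>E. b (u p) e *\<^sub>R e)" by auto
  have fin: "finite E" using E by (simp add: orthonormal_def)
  \<comment> \<open>The matrix of \<open>rank_one_sum u k a\<close> in the system \<open>E\<close>.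
    The chain of interchanged sums below computes the sum of its squared entries.\<close>
  define M where "M e f = (\<Sum>p<k. a p * b (u p) e * b (u p) f)" for e f
  have parseval: "b (u p) (u q) = (\<Sum>e\<in>E. b (u p) e * b (u q) e)" if "p < k" for p q
    using b_sym[of "u q"]
    by (subst U[OF that]) (simp only: b.sum_left b.scaleR_left real_scaleR_def)
  have "(\<Sum>e\<in>E. \<Sum>f\<in>E. (M e f)\<^sup>2)
     = (\<Sum>e\<in>E. \<Sum>f\<in>E. \<Sum>p<k. \<Sum>q<k. (a p * b (u p) e * b (u p) f) * (a q * b (u q) e * b (u q) f))"
    by (simp add: M_def power2_eq_square sum_product)
  also have "\<dots> = (\<Sum>e\<in>E. \<Sum>p<k. \<Sum>f\<in>E. \<Sum>q<k. (a p * b (u p) e * b (u p) f) * (a q * b (u q) e * b (u q) f))"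
    by (intro sum.cong refl sum.swap)
  also have "\<dots> = (\<Sum>p<k. \<Sum>e\<in>E. \<Sum>f\<in>E. \<Sum>q<k. (a p * b (u p) e * b (u p) f) * (a q * b (u q) e * b (u q) f))"
    by (rule sum.swap)
  also have "\<dots> = (\<Sum>p<k. \<Sum>e\<in>E. \<Sum>q<k. \<Sum>f\<in>E. (a p * b (u p) e * b (u p) f) * (a q * b (u q) e * b (u q) f))"
    by (intro sum.cong refl sum.swap)
  also have "\<dots> = (\<Sum>p<k. \<Sum>q<k. \<Sum>e\<in>E. \<Sum>f\<in>E. (a p * b (u p) e * b (u p) f) * (a q * b (u q) e * b (u q) f))"
    by (intro sum.cong refl sum.swap)
  also have "\<dots> = (\<Sum>p<k. \<Sum>q<k. a p * a q * (\<Sum>e\<in>E. \<Sum>f\<in>E. (b (u p) e * b (u q) e) * (b (u p) f * b (u q) f)))"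
    by (simp add: sum_distrib_left mult_ac)
  also have "\<dots> = hs_norm2 u k a"
    unfolding hs_norm2_def
    by (intro sum.cong refl) (simp add: parseval power2_eq_square sum_product)
  finally have hs: "hs_norm2 u k a = (\<Sum>e\<in>E. \<Sum>f\<in>E. (M e f)\<^sup>2)" by simp
  have "rank_one_sum u k a e0 = (\<Sum>p<k. (a p * b e0 (u p)) *\<^sub>R (\<Sum>f\<in>E. b (u p) f *\<^sub>R f))"
    unfolding rank_one_sum_def by (intro sum.cong refl) (simp add: U[symmetric])
  also have "\<dots> = (\<Sum>p<k. \<Sum>f\<in>E. (a p * b (u p) e0 * b (u p) f) *\<^sub>R f)"
    by (simp add: scaleR_sum_right b_sym[of e0])
  also have "\<dots> = (\<Sum>f\<in>E. M e0 f *\<^sub>R f)"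
    by (subst sum.swap) (simp add: M_def scaleR_sum_left)
  finally have "(norm (rank_one_sum u k a e0))\<^sup>2 = (\<Sum>f\<in>E. (M e0 f)\<^sup>2)"
    by (simp add: orthonormal_norm_sum[OF E(1)])
  also have "\<dots> \<le> (\<Sum>e\<in>E. \<Sum>f\<in>E. (M e f)\<^sup>2)"
    by (rule member_le_sum[of e0 E "\<lambda>e. \<Sum>f\<in>E. (M e f)\<^sup>2"])
       (auto intro: sum_nonneg E fin)
  finally have le: "(norm (rank_one_sum u k a e0))\<^sup>2 \<le> hs_norm2 u k a" by (simp add: hs)
  have "rank_one_sum u k a h = norm h *\<^sub>R rank_one_sum u k a e0"
    using False by (simp add: rank_one_sum_def e0_def b.scaleR_left scaleR_sum_right field_simps)
  then show ?thesis
    using mult_right_mono[OF le, of "(norm h)\<^sup>2"] by (simp add: power_mult_distrib mult.commute)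
qed

section \<open>Near-minimisers of the Hilbert-Schmidt norm over convex combinations\<close>

lemma hs_norm2_parallelogram:
  "hs_norm2 u k (\<lambda>p. a p - c p)
     = 2 * hs_norm2 u k a + 2 * hs_norm2 u k c - 4 * hs_norm2 u k (\<lambda>p. (a p + c p) / 2)"
  unfolding hs_norm2_def sum_distrib_left sum.distrib[symmetric] sum_subtractf[symmetric]
  by (intro sum.cong refl) (simp add: field_simps)

text \<open>Coefficients vanish from \<open>k\<close> on, so that a convex combination of length
  \<open>k\<close> is also one of every greater length and any two can be compared at a common
  length.\<close>

definition weights :: "nat \<Rightarrow> (nat \<Rightarrow> real) set" where
  "weights k = {a. (\<forall>p. 0 \<le> a p) \<and> (\<forall>p\<ge>k. a p = 0) \<and> (\<Sum>p<k. a p) = 1}"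

lemma sum_lessThan_extend:
  fixes g :: "nat \<Rightarrow> 'v::comm_monoid_add"
  assumes "k \<le> k'" "\<And>p. k \<le> p \<Longrightarrow> g p = 0"
  shows "(\<Sum>p<k'. g p) = (\<Sum>p<k. g p)"
  using assms by (intro sum.mono_neutral_right) auto

lemma weights_mono: "a \<in> weights k \<Longrightarrow> k \<le> k' \<Longrightarrow> a \<in> weights k'"
  using sum_lessThan_extend[of k k' a] by (auto simp: weights_def)

lemma rank_one_sum_extend:
  "a \<in> weights k \<Longrightarrow> k \<le> k' \<Longrightarrow> rank_one_sum u k' a h = rank_one_sum u k a h"
  unfolding rank_one_sum_def by (intro sum_lessThan_extend) (auto simp: weights_def)

lemma hs_norm2_extend:
  assumes "a \<in> weights k" "k \<le> k'" shows "hs_norm2 u k' a = hs_norm2 u k a"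
proof -
  have "(\<Sum>q<k'. a p * a q * (b (u p) (u q))\<^sup>2) = (\<Sum>q<k. a p * a q * (b (u p) (u q))\<^sup>2)" for p
    using assms by (intro sum_lessThan_extend) (auto simp: weights_def)
  then show ?thesis unfolding hs_norm2_def
    using assms by (simp, intro sum_lessThan_extend) (auto simp: weights_def)
qed

lemma weights_average:
  assumes "a \<in> weights k" "c \<in> weights k"
  shows "(\<lambda>p. (a p + c p) / 2) \<in> weights k"
  using assms by (auto simp: weights_def sum.distrib simp flip: sum_divide_distrib)

lemma rank_one_sum_diff:
  "rank_one_sum u k a h - rank_one_sum u k c h = rank_one_sum u k (\<lambda>p. a p - c p) h"
  by (simp add: rank_one_sum_def sum_subtractf left_diff_distrib scaleR_left_diff_distrib)

lemma weights_nonneg_hs: "a \<in> weights k \<Longrightarrow> 0 \<le> hs_norm2 u k a"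
  unfolding hs_norm2_def by (intro sum_nonneg) (auto simp: weights_def)

text \<open>The average of two convex combinations is again one, so its squared norm is at least
  \<open>d\<close>. The parallelogram law then bounds the squared Hilbert-Schmidt norm of the
  difference by \<open>2 * (d + \<epsilon>) + 2 * (d + \<epsilon>) - 4 * d\<close>.\<close>

lemma near_minimal_weights_close:
  assumes low: "\<And>k a. a \<in> weights k \<Longrightarrow> d \<le> hs_norm2 u k a"
    and a: "a \<in> weights k" "hs_norm2 u k a \<le> d + \<epsilon>"
    and c: "c \<in> weights l" "hs_norm2 u l c \<le> d + \<epsilon>"
  shows "(norm (rank_one_sum u k a h - rank_one_sum u l c h))\<^sup>2 \<le> 4 * \<epsilon> * (norm h)\<^sup>2"
proof -
  define m where "m = max k l"
  have am: "a \<in> weights m" and cm: "c \<in> weights m"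
    using a c weights_mono by (auto simp: m_def)
  have ext: "rank_one_sum u k a h = rank_one_sum u m a h" "rank_one_sum u l c h = rank_one_sum u m c h"
     "hs_norm2 u m a = hs_norm2 u k a" "hs_norm2 u m c = hs_norm2 u l c"
    using rank_one_sum_extend[OF a(1), of m u h] rank_one_sum_extend[OF c(1), of m u h]
      hs_norm2_extend[OF a(1), of m u] hs_norm2_extend[OF c(1), of m u]
    by (simp_all add: m_def)
  have "hs_norm2 u m (\<lambda>p. a p - c p) \<le> 4 * \<epsilon>"
    using low[OF weights_average[OF am cm]] a(2) c(2)
    unfolding hs_norm2_parallelogram ext by linarith
  then show ?thesis
    using hs_norm2_bound[of u m "\<lambda>p. a p - c p" h] unfolding ext rank_one_sum_diff
    by (meson mult_right_mono order_trans zero_le_power2)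
qed

lemma isometry_preserves_form:
  assumes "linear V" and iso: "\<And>x. norm (V x) = norm x"
  shows "b (V x) (V y) = b x y"
proof -
  have polar: "2 * b x y = (norm (x + y))\<^sup>2 - (norm x)\<^sup>2 - (norm y)\<^sup>2" for x y
    by (simp add: b_norm[symmetric] b.add_left b.add_right b_sym[of y x])
  show ?thesis
    using polar[of x y] polar[of "V x" "V y"] iso[of "x + y"] iso[of x] iso[of y]
    by (simp add: linear_add[OF assms(1)])
qed

lemma b_rank_one_sum: "b (rank_one_sum u k a h) g = (\<Sum>p<k. a p * b h (u p) * b g (u p))"
  by (simp add: rank_one_sum_def b.sum_left b.scaleR_left b_sym[of g])

lemma linear_rank_one_sum: "linear (rank_one_sum u k a)"
  by (rule linearI)
     (simp_all add: rank_one_sum_def b.add_left b.scaleR_left algebra_simps sum.distrib scaleR_sum_right)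

lemma rank_one_sum_trace:
  "(\<Sum>g\<in>G. b (rank_one_sum u k a g) g) = (\<Sum>p<k. a p * (\<Sum>g\<in>G. (b (u p) g)\<^sup>2))"
  unfolding b_rank_one_sum
  by (subst sum.swap) (simp add: sum_distrib_left b_sym[of _ "u _"] power2_eq_square mult_ac)

text \<open>Bessel's inequality for each \<open>u p\<close>, averaged with the weights. In the limit
  this bound makes the eigenspaces finite dimensional.\<close>

lemma rank_one_sum_trace_le:
  assumes a: "a \<in> weights k" and E: "orthonormal E" and u: "\<And>p. norm (u p) = c"
  shows "(\<Sum>e\<in>E. b (rank_one_sum u k a e) e) \<le> c\<^sup>2"
proof -
  have "(\<Sum>e\<in>E. b (rank_one_sum u k a e) e) = (\<Sum>p<k. a p * (\<Sum>e\<in>E. (b (u p) e)\<^sup>2))"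
    by (rule rank_one_sum_trace)
  also have "\<dots> \<le> (\<Sum>p<k. a p * c\<^sup>2)"
    using a bessel[OF E, of "u _"] by (intro sum_mono mult_left_mono) (auto simp: weights_def u)
  also have "\<dots> = c\<^sup>2"
    using a by (simp add: weights_def flip: sum_distrib_right)
  finally show ?thesis .
qed

text \<open>This lower bound survives the passage to the limit and prevents the limit operator from
  vanishing.\<close>

lemma rank_one_sum_trace_ge:
  assumes a: "a \<in> weights k" and u: "\<And>p. c \<le> (\<Sum>g\<in>G. (b (u p) g)\<^sup>2)"
  shows "c \<le> (\<Sum>g\<in>G. b (rank_one_sum u k a g) g)"
proof -
  have "c = (\<Sum>p<k. a p * c)"
    using a by (simp add: weights_def flip: sum_distrib_right)
  also have "\<dots> \<le> (\<Sum>p<k. a p * (\<Sum>g\<in>G. (b (u p) g)\<^sup>2))"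
    using a u by (intro sum_mono mult_left_mono) (auto simp: weights_def)
  also have "\<dots> = (\<Sum>g\<in>G. b (rank_one_sum u k a g) g)"
    by (simp add: rank_one_sum_trace)
  finally show ?thesis .
qed

text \<open>When \<open>u (Suc p) = V (u p)\<close>, shifting the coefficients replaces the operator
  R by \<open>V R V\<^sup>*\<close>.\<close>

definition shift_weights :: "(nat \<Rightarrow> real) \<Rightarrow> nat \<Rightarrow> real" where
  "shift_weights a p = (case p of 0 \<Rightarrow> 0 | Suc q \<Rightarrow> a q)"

lemma shift_weights_simps [simp]:
  "shift_weights a 0 = 0" "shift_weights a (Suc q) = a q"
  by (simp_all add: shift_weights_def)

lemma shift_weights_in_weights:
  "a \<in> weights k \<Longrightarrow> shift_weights a \<in> weights (Suc k)"
  by (auto simp: weights_def sum.lessThan_Suc_shift shift_weights_def split: nat.splits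
      simp del: sum.lessThan_Suc)

text \<open>A minimising sequence for the Hilbert-Schmidt norm is Cauchy, and its limit is
  \<open>A\<close>. Shifting the weights keeps the norm, because \<open>V\<close> preserves the
  form, so the shifted sequence is minimising too and has the same limit; this yields that
  \<open>A\<close> commutes with \<open>V\<close>.\<close>

lemma invariant_operator:
  fixes V :: "'h \<Rightarrow> 'h"
  assumes lin: "linear V" and iso: "\<And>x. norm (V x) = norm x"
    and u: "\<And>p. u (Suc p) = V (u p)"
  obtains A k a where "\<And>n. a n \<in> weights (k n)"
    "\<And>n h. norm (rank_one_sum u (k n) (a n) h - A h) \<le> inverse (Suc n) * norm h"
    "\<And>h. A (V h) = V (A h)"
proof -
  note Vb = isometry_preserves_form[OF lin iso]
  have shift_op: "rank_one_sum u (Suc k) (shift_weights a) (V h) = V (rank_one_sum u k a h)" for k a h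
    by (simp add: rank_one_sum_def sum.lessThan_Suc_shift u Vb linear_sum[OF lin] linear_scale[OF lin]
        del: sum.lessThan_Suc)
  have shift_hs: "hs_norm2 u (Suc k) (shift_weights a) = hs_norm2 u k a" for k a
    by (simp add: hs_norm2_def sum.lessThan_Suc_shift u Vb del: sum.lessThan_Suc)
  define S where "S = {hs_norm2 u k a | k a. a \<in> weights k}"
  define d where "d = Inf S"
  have "(\<lambda>p. if p = 0 then 1 else 0) \<in> weights 1" by (auto simp: weights_def)
  then have Sne: "S \<noteq> {}" unfolding S_def by blast
  have bdd: "bdd_below S"
    by (rule bdd_belowI[of _ 0]) (auto simp: S_def weights_nonneg_hs)
  have low: "d \<le> hs_norm2 u k a" if "a \<in> weights k" for k a
    unfolding d_def using that by (intro cInf_lower[OF _ bdd]) (auto simp: S_def)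
  \<comment> \<open>Chosen so that the bound \<open>4 * \<epsilon> n\<close> on squared distances
    has square root 1/(n+1).\<close>
  define \<epsilon> where "\<epsilon> n = (inverse (Suc n))\<^sup>2 / (4::real)" for n
  have "\<exists>k a. a \<in> weights k \<and> hs_norm2 u k a \<le> d + \<epsilon> n" for n
  proof -
    have "Inf S < d + \<epsilon> n" by (simp add: d_def \<epsilon>_def)
    then obtain s where "s \<in> S" "s < d + \<epsilon> n" using cInf_lessD[OF Sne] by blast
    then show ?thesis unfolding S_def by (auto intro: less_imp_le)
  qed
  then obtain k a where ka: "\<And>n. a n \<in> weights (k n)" "\<And>n. hs_norm2 u (k n) (a n) \<le> d + \<epsilon> n"
    by metis
  define R where "R n = rank_one_sum u (k n) (a n)" for n
  have \<epsilon>_anti: "\<epsilon> n \<le> \<epsilon> m" if "m \<le> n" for m n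
    using that by (auto simp: \<epsilon>_def intro!: divide_right_mono power_mono le_imp_inverse_le)
  have root: "norm x \<le> inverse (Suc n) * norm h" if "(norm x)\<^sup>2 \<le> 4 * \<epsilon> n * (norm h)\<^sup>2" for x h :: 'h and n
  proof (rule power2_le_imp_le)
    show "(norm x)\<^sup>2 \<le> (inverse (Suc n) * norm h)\<^sup>2"
      using that by (simp add: \<epsilon>_def power_mult_distrib)
  qed simp
  have close: "norm (R m h - R n h) \<le> inverse (Suc m) * norm h" if "m \<le> n" for m n h
    unfolding R_def using ka(2)[of n] \<epsilon>_anti[OF that]
    by (intro root near_minimal_weights_close[OF low ka(1) ka(2) ka(1)]) auto
  \<comment> \<open>By \<open>shift_op\<close>, \<open>V (R n h)\<close> is the value at
    \<open>V h\<close> of the combination with shifted weights, which is as nearly minimal as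
    \<open>R n\<close>.\<close>
  have close': "norm (R n (V h) - V (R n h)) \<le> inverse (Suc n) * norm h" for n h
  proof -
    have "hs_norm2 u (Suc (k n)) (shift_weights (a n)) \<le> d + \<epsilon> n"
      using ka(2)[of n] by (simp only: shift_hs)
    then have "norm (R n (V h) - V (R n h)) \<le> inverse (Suc n) * norm (V h)"
      unfolding R_def shift_op[symmetric]
      by (intro root near_minimal_weights_close[OF low ka(1) ka(2) shift_weights_in_weights[OF ka(1)]])
    then show ?thesis by (simp add: iso)
  qed
  have "Cauchy (\<lambda>n. R n h)" for h
  proof (rule metric_CauchyI)
    fix e :: real assume "e > 0"
    then obtain N where N: "inverse (real (Suc N)) * norm h < e / 2"
      using order_tendstoD(2)[OF inverse_Suc_times_tendsto_0, of "e / 2" "norm h"] by (auto simp: eventually_sequentially)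
    have "dist (R m h) (R n h) < e" if "m \<ge> N" "n \<ge> N" for m n
      using close[OF that(1), of h] close[OF that(2), of h] N
      using dist_triangle3[of "R m h" "R n h" "R N h"] by (simp add: dist_norm)
    then show "\<exists>M. \<forall>m\<ge>M. \<forall>n\<ge>M. dist (R m h) (R n h) < e" by blast
  qed
  then have "\<exists>l. (\<lambda>n. R n h) \<longlonglongrightarrow> l" for h
    using Cauchy_convergent_iff convergent_def by blast
  then obtain A where A: "\<And>h. (\<lambda>n. R n h) \<longlonglongrightarrow> A h" by metis
  have lim: "norm (R m h - A h) \<le> inverse (Suc m) * norm h" for m h
    by (rule LIMSEQ_le_const2[OF tendsto_norm[OF tendsto_diff[OF tendsto_const A]]])
       (use close in blast)
  have "bounded_linear V"
    using lin by (intro bounded_linear_intro[of V 1]) (auto simp: linear_add linear_scale iso)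
  then have VA: "(\<lambda>n. V (R n h)) \<longlonglongrightarrow> V (A h)" for h
    using A bounded_linear.tendsto by blast
  have "A (V h) = V (A h)" for h
  proof -
    have "(\<lambda>n. R n (V h) - V (R n h)) \<longlonglongrightarrow> 0"
      by (rule Lim_null_comparison[OF _ inverse_Suc_times_tendsto_0[of "norm h"]]) (use close' in auto)
    moreover have "(\<lambda>n. R n (V h) - V (R n h)) \<longlonglongrightarrow> A (V h) - V (A h)"
      by (intro tendsto_diff A VA)
    ultimately have "A (V h) - V (A h) = 0" using LIMSEQ_unique by blast
    then show ?thesis by simp
  qed
  then show thesis using that[of a k A] ka(1) lim unfolding R_def by blast
qed

subsection \<open>Weak mixing of isometries\<close>

text \<open>\<open>A\<close> is symmetric and positive, and it is compact as a uniform limit of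
  finite rank operators. The supremum \<open>l\<close> of its quadratic form on the unit sphere is
  therefore attained at an eigenvector. Linearity and the trace bound come out of the same limit and
  are passed on.\<close>

lemma top_eigenvector:
  fixes A :: "'h \<Rightarrow> 'h"
  assumes ka: "\<And>n. a n \<in> weights (k n)"
    and approx: "\<And>n h. norm (rank_one_sum u (k n) (a n) h - A h) \<le> inverse (Suc n) * norm h"
    and unorm: "\<And>p. norm (u p) = c"
    and pos: "0 < b (A g) g"
  obtains l h where "0 < l" "h \<noteq> 0" "A h = l *\<^sub>R h"
    "linear A" "\<And>E. orthonormal E \<Longrightarrow> (\<Sum>e\<in>E. b (A e) e) \<le> c\<^sup>2"
proof -
  define R where "R n = rank_one_sum u (k n) (a n)" for n
  note A = tendsto_of_inverse_Suc_bound[OF approx, folded R_def]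
  have linR: "linear (R n)" for n by (simp add: R_def linear_rank_one_sum)
  have linA: "linear A"
  proof (rule linearI)
    show "A (x + y) = A x + A y" for x y
      using tendsto_add[OF A[of x] A[of y]] A[of "x + y"]
      by (intro LIMSEQ_unique[OF A[of "x + y"]]) (simp add: linear_add[OF linR])
    show "A (r *\<^sub>R x) = r *\<^sub>R A x" for r x
      using tendsto_scaleR[OF tendsto_const A[of x], of r]
      by (intro LIMSEQ_unique[OF A[of "r *\<^sub>R x"]]) (simp add: linear_scale[OF linR])
  qed
  have bA: "(\<lambda>n. b (R n x) y) \<longlonglongrightarrow> b (A x) y" for x y
    by (intro b.tendsto A tendsto_const)
  have A_sym: "b (A x) y = b (A y) x" for x y
  proof (rule LIMSEQ_unique[OF bA])
    show "(\<lambda>n. b (R n x) y) \<longlonglongrightarrow> b (A y) x"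
      using bA[of y x] by (simp add: R_def b_rank_one_sum mult_ac)
  qed
  have A_nonneg: "0 \<le> b (A x) x" for x
    by (rule LIMSEQ_le_const[OF bA])
       (use ka in \<open>auto simp: R_def b_rank_one_sum weights_def mult.assoc intro!: sum_nonneg exI[of _ 0]\<close>)
  have trace: "(\<Sum>e\<in>E. b (A e) e) \<le> c\<^sup>2" if "orthonormal E" for E
    by (rule LIMSEQ_le_const2[OF tendsto_sum[OF bA]])
       (use rank_one_sum_trace_le[OF ka that, of u c] unorm in \<open>auto simp: R_def\<close>)
  define Q where "Q = {b (A x) x | x. norm x = 1}"
  define l where "l = Sup Q"
  have "b (A x) x \<le> c\<^sup>2" if "norm x = 1" for x
    using trace[of "{x}"] that by (simp add: orthonormal_def b_norm)
  then have bddQ: "bdd_above Q" by (intro bdd_aboveI[of _ "c\<^sup>2"]) (auto simp: Q_def)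
  have up1: "b (A x) x \<le> l" if "norm x = 1" for x
    unfolding l_def using that by (intro cSup_upper[OF _ bddQ]) (auto simp: Q_def)
  have up: "b (A x) x \<le> l * (norm x)\<^sup>2" for x
  proof (cases "x = 0")
    case True then show ?thesis by (simp add: b.zero_right)
  next
    case False
    have "b (A (x /\<^sub>R norm x)) (x /\<^sub>R norm x) \<le> l" using False by (intro up1) simp
    then show ?thesis using False
      by (simp add: linear_scale[OF linA] b.scaleR_left b.scaleR_right field_simps power2_eq_square)
  qed
  have gnz: "g \<noteq> 0" using pos by (auto simp: b.zero_right)
  have l0: "0 < l" using up[of g] pos gnz
    by (smt (verit) mult_nonpos_nonneg zero_le_power2)
  \<comment> \<open>Cauchy-Schwarz for the form \<open>b (A x) y\<close> at the vectors
    \<open>x\<close> and \<open>A x\<close>. It shows below that a maximising sequence consists of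
    approximate eigenvectors.\<close>
  have A_norm2: "(norm (A x))\<^sup>2 \<le> l * b (A x) x" for x
  proof (cases "A x = 0")
    case True then show ?thesis using A_nonneg[of x] l0 by simp
  next
    case False
    have "(b (A x) (A x))\<^sup>2 \<le> b (A x) x * b (A (A x)) (A x)"
      by (rule psd_form_Cauchy_Schwarz[of "\<lambda>x y. b (A x) y"])
         (auto simp: linear_add[OF linA] linear_scale[OF linA] b.add_left b.scaleR_left A_nonneg
            intro: A_sym)
    also have "\<dots> \<le> b (A x) x * (l * (norm (A x))\<^sup>2)"
      by (intro mult_left_mono up A_nonneg)
    finally show ?thesis using False
      by (simp add: b_norm power2_eq_square mult_ac)
  qed
  have A_norm: "norm (A x) \<le> norm x * l" for x
  proof (rule power2_le_imp_le)
    show "(norm (A x))\<^sup>2 \<le> (norm x * l)\<^sup>2"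
      using order_trans[OF A_norm2[of x] mult_left_mono[OF up[of x], of l]] l0
      by (simp add: power2_eq_square mult_ac)
  qed (use l0 in simp)
  have blA: "bounded_linear A"
    using linA A_norm by (intro bounded_linear_intro[of A l]) (auto simp: linear_add linear_scale)
  have "\<exists>x. norm x = 1 \<and> l - inverse (Suc n) < b (A x) x" for n
  proof -
    have "b (A (g /\<^sub>R norm g)) (g /\<^sub>R norm g) \<in> Q" using gnz unfolding Q_def by force
    then have "Q \<noteq> {}" by blast
    moreover have "l - inverse (Suc n) < Sup Q" by (simp add: l_def)
    ultimately obtain s where "s \<in> Q" "l - inverse (Suc n) < s"
      using less_cSupD[of Q] by blast
    then show ?thesis by (auto simp: Q_def)
  qed
  then obtain x where x1: "\<And>n. norm (x n) = 1" and xl: "\<And>n. l - inverse (Suc n) < b (A (x n)) (x n)"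
    by metis
  have "norm (A (x n) - l *\<^sub>R x n) ^ 2 \<le> inverse (Suc n) * l" for n
  proof -
    have "norm (A (x n) - l *\<^sub>R x n) ^ 2 = (norm (A (x n)))\<^sup>2 - 2 * l * b (A (x n)) (x n) + l\<^sup>2"
      by (simp add: b_norm[symmetric] b.diff_left b.diff_right b.scaleR_left b.scaleR_right
          b_sym[of "x n" "A (x n)"]) (simp add: b_norm x1 power2_eq_square algebra_simps)
    also have "\<dots> \<le> l * (l - b (A (x n)) (x n))"
      using A_norm2[of "x n"] by (simp add: power2_eq_square algebra_simps)
    also have "\<dots> \<le> l * inverse (Suc n)"
      using xl[of n] l0 by (intro mult_left_mono) auto
    finally show ?thesis by (simp add: mult.commute)
  qed
  then have "(\<lambda>n. norm (A (x n) - l *\<^sub>R x n) ^ 2) \<longlonglongrightarrow> 0"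
    by (intro Lim_null_comparison[OF _ inverse_Suc_times_tendsto_0[of l]]) auto
  then have approx_eig: "(\<lambda>n. A (x n) - l *\<^sub>R x n) \<longlonglongrightarrow> 0"
    by (simp add: tendsto_norm_zero_iff)
  \<comment> \<open>A diagonal subsequence along which only the inner products with the countably
    many \<open>u p\<close> converge. This is enough, as each \<open>R m\<close> involves finitely
    many of them.\<close>
  obtain r where r: "strict_mono r"
    and conv: "\<And>y. y \<in> range u \<Longrightarrow> \<exists>L. (\<lambda>n. b (x (r n)) y) \<longlonglongrightarrow> L"
  proof (rule function_convergent_subsequence[of "range u" "\<lambda>n. b (x n)" c])
    show "norm (b (x n) y) \<le> c" if "y \<in> range u" for n y
      using b_bound[of "x n" y] that unorm by (auto simp: x1)
  qed auto
  have Rconv: "Cauchy (\<lambda>n. R m (x (r n)))" for m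
  proof -
    obtain L where L: "\<And>p. (\<lambda>n. b (x (r n)) (u p)) \<longlonglongrightarrow> L p" using conv by (metis rangeI)
    have "(\<lambda>n. R m (x (r n))) \<longlonglongrightarrow> (\<Sum>p<k m. (a m p * L p) *\<^sub>R u p)"
      unfolding R_def rank_one_sum_def by (intro tendsto_intros L)
    then show ?thesis by (rule LIMSEQ_imp_Cauchy)
  qed
  have "Cauchy (\<lambda>n. A (x (r n)))"
  proof (rule metric_CauchyI)
    fix e :: real assume e: "e > 0"
    then obtain m where m: "inverse (real (Suc m)) < e / 3"
      using reals_Archimedean[of "e / 3"] by auto
    have cl: "norm (R m (x n) - A (x n)) < e / 3" for n
      using approx[of m "x n"] m x1[of n] by (simp add: R_def)
    obtain N where N: "\<And>i j. i \<ge> N \<Longrightarrow> j \<ge> N \<Longrightarrow> dist (R m (x (r i))) (R m (x (r j))) < e / 3"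
      using metric_CauchyD[OF Rconv[of m], of "e / 3"] e by auto
    have "dist (A (x (r i))) (A (x (r j))) < e" if "i \<ge> N" "j \<ge> N" for i j
      using dist_triangle_third[of "A (x (r i))" "R m (x (r i))" e "R m (x (r j))" "A (x (r j))"]
        cl[of "r i"] cl[of "r j"] N[OF that]
      by (simp add: dist_norm norm_minus_commute)
    then show "\<exists>M. \<forall>i\<ge>M. \<forall>j\<ge>M. dist (A (x (r i))) (A (x (r j))) < e" by blast
  qed
  then obtain y where y: "(\<lambda>n. A (x (r n))) \<longlonglongrightarrow> y"
    using Cauchy_convergent_iff convergent_def by blast
  \<comment> \<open>The difference equals \<open>l *\<^sub>R x (r n)\<close>, so convergence of the
    images gives norm convergence of the vectors because \<open>l\<close> is positive.\<close>
  have "(\<lambda>n. A (x (r n)) - (A (x (r n)) - l *\<^sub>R x (r n))) \<longlonglongrightarrow> y - 0"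
    using LIMSEQ_subseq_LIMSEQ[OF approx_eig r] by (intro tendsto_diff y) (simp add: o_def)
  then have "(\<lambda>n. inverse l *\<^sub>R (l *\<^sub>R x (r n))) \<longlonglongrightarrow> inverse l *\<^sub>R y"
    by (intro tendsto_scaleR tendsto_const) simp
  then have xy: "(\<lambda>n. x (r n)) \<longlonglongrightarrow> inverse l *\<^sub>R y" using l0 by simp
  have "norm (inverse l *\<^sub>R y) = 1"
    using LIMSEQ_unique[OF tendsto_norm[OF xy]] by (simp add: x1)
  then have nz: "inverse l *\<^sub>R y \<noteq> 0" by auto
  have "A (inverse l *\<^sub>R y) = y"
    using LIMSEQ_unique[OF bounded_linear.tendsto[OF blA xy] y] .
  then have "A (inverse l *\<^sub>R y) = l *\<^sub>R (inverse l *\<^sub>R y)" using l0 by simp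
  then show thesis using that l0 nz linA trace by blast
qed

text \<open>The top eigenspace of the operator from \<open>invariant_operator\<close> is nonzero,
  invariant under \<open>V\<close>, and finite dimensional by the trace bound. The hypothesis
  \<open>nofin\<close> concerns real spans.\<close>

lemma weak_mixing:
  fixes V :: "'h \<Rightarrow> 'h"
  assumes lin: "linear V" and iso: "\<And>x. norm (V x) = norm x"
    and nofin: "\<And>B. finite B \<Longrightarrow> V ` span B \<subseteq> span B \<Longrightarrow> span B = {0}"
    and G: "finite G" and e: "0 < e"
  shows "\<exists>p\<ge>P. \<forall>g\<in>G. \<bar>b ((V ^^ p) w) g\<bar> < e"
proof (rule ccontr)
  assume "\<not> ?thesis"
  then have neg: "\<exists>g\<in>G. e \<le> \<bar>b ((V ^^ p) w) g\<bar>" if "p \<ge> P" for p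
    using that by (auto simp: not_less)
  \<comment> \<open>The orbit starts at time \<open>P\<close>, so that the failure in
    \<open>neg\<close> holds for every index.\<close>
  define u where "u p = (V ^^ (P + p)) w" for p
  have u: "u (Suc p) = V (u p)" for p by (simp add: u_def)
  have unorm: "norm (u p) = norm (u 0)" for p by (induction p) (simp_all add: u iso)
  have ulow: "e\<^sup>2 \<le> (\<Sum>g\<in>G. (b (u p) g)\<^sup>2)" for p
  proof -
    obtain g where g: "g \<in> G" "e \<le> \<bar>b (u p) g\<bar>" using neg[of "P + p"] by (auto simp: u_def)
    have "e\<^sup>2 \<le> (b (u p) g)\<^sup>2" using g e by (metis abs_le_square_iff abs_of_pos)
    also have "\<dots> \<le> (\<Sum>g\<in>G. (b (u p) g)\<^sup>2)" using g G by (intro member_le_sum) auto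
    finally show ?thesis .
  qed
  obtain A k a where ka: "\<And>n. a n \<in> weights (k n)"
    and approx: "\<And>n h. norm (rank_one_sum u (k n) (a n) h - A h) \<le> inverse (Suc n) * norm h"
    and comm: "\<And>h. A (V h) = V (A h)"
    by (rule invariant_operator[of V u, OF lin iso u]) (rule that)
  have A: "(\<lambda>n. rank_one_sum u (k n) (a n) h) \<longlonglongrightarrow> A h" for h
    by (rule tendsto_of_inverse_Suc_bound[OF approx])
  have "e\<^sup>2 \<le> (\<Sum>g\<in>G. b (A g) g)"
  proof (rule LIMSEQ_le_const)
    show "(\<lambda>n. \<Sum>g\<in>G. b (rank_one_sum u (k n) (a n) g) g) \<longlonglongrightarrow> (\<Sum>g\<in>G. b (A g) g)"
      by (intro tendsto_sum b.tendsto A tendsto_const)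
  qed (auto intro: rank_one_sum_trace_ge[OF ka] ulow)
  then have "0 < (\<Sum>g\<in>G. b (A g) g)"
    using e by (smt (verit) zero_less_power)
  then obtain g where "0 < b (A g) g"
    by (meson not_less sum_nonpos)
  from top_eigenvector[OF ka approx unorm this]
  obtain l h where l: "0 < l" and h: "h \<noteq> 0" "A h = l *\<^sub>R h" and linA: "linear A"
    and trace: "\<And>E. orthonormal E \<Longrightarrow> (\<Sum>e\<in>E. b (A e) e) \<le> (norm (u 0))\<^sup>2" by blast
  define W where "W = {h. A h = l *\<^sub>R h}"
  have W: "subspace W"
    unfolding W_def using linear_0[OF linA]
    by (intro subspaceI) (auto simp: linear_add[OF linA] linear_scale[OF linA] algebra_simps)
  \<comment> \<open>An orthonormal system in the eigenspace with n elements contributes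
    \<open>n * l\<close> to the trace, which bounds n. One of largest cardinality then spans the
    eigenspace.\<close>
  define C where "C = card ` {E. orthonormal E \<and> E \<subseteq> W}"
  have card_le: "card E \<le> nat \<lceil>(norm (u 0))\<^sup>2 / l\<rceil>" if "orthonormal E" "E \<subseteq> W" for E
  proof -
    have "(\<Sum>e\<in>E. b (A e) e) = (\<Sum>e\<in>E. l)"
      using that by (intro sum.cong) (auto simp: orthonormal_def W_def b.scaleR_left subset_iff)
    then have "card E * l \<le> (norm (u 0))\<^sup>2" using trace[OF that(1)] by simp
    then have "card E \<le> (norm (u 0))\<^sup>2 / l" using l by (simp add: field_simps)
    then show ?thesis by linarith
  qed
  then have finC: "finite C" unfolding C_def by (intro finite_subset[OF _ finite_atMost]) auto
  have "{} \<in> {E. orthonormal E \<and> E \<subseteq> W}" by (simp add: orthonormal_def)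
  then have "C \<noteq> {}" unfolding C_def by blast
  then obtain E where E: "orthonormal E" "E \<subseteq> W" and Emax: "card E = Max C"
    using Max_in[OF finC] unfolding C_def by (smt (verit) image_iff mem_Collect_eq)
  have finE: "finite E" using E by (simp add: orthonormal_def)
  have "W \<subseteq> span E"
  proof
    fix x assume x: "x \<in> W"
    define r where "r = x - (\<Sum>f\<in>E. b x f *\<^sub>R f)"
    have sW: "(\<Sum>f\<in>E. b x f *\<^sub>R f) \<in> W"
      using E by (intro subspace_sum[OF W] subspace_scale[OF W]) auto
    have "r = 0"
    proof (rule ccontr)
      assume nz: "r \<noteq> 0"
      note ins = orthonormal_insert[OF E(1) r_def nz]
      have "r \<in> W" unfolding r_def by (intro subspace_diff[OF W] x sW)
      then have "insert (r /\<^sub>R norm r) E \<subseteq> W" using E(2) by (auto intro: subspace_scale[OF W])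
      then have "card (insert (r /\<^sub>R norm r) E) \<in> C" using ins by (auto simp: C_def)
      then have "card (insert (r /\<^sub>R norm r) E) \<le> card E" unfolding Emax by (intro Max_ge finC)
      then show False using ins(2) finE by simp
    qed
    then have "x = (\<Sum>f\<in>E. b x f *\<^sub>R f)" by (simp add: r_def)
    moreover have "(\<Sum>f\<in>E. b x f *\<^sub>R f) \<in> span E"
      by (intro span_sum span_scale span_base)
    ultimately show "x \<in> span E" by simp
  qed
  then have WE: "span E = W" using E(2) W by (simp add: span_minimal subset_antisym)
  have "V ` W \<subseteq> W" by (auto simp: W_def comm linear_scale[OF lin])
  then have "W = {0}" using nofin[OF finE] by (simp add: WE)
  then show False using h by (auto simp: W_def)
qed

end

subsection \<open>The ruler sequence\<close>

text \<open>The sequence 0, 1, 0, 2, 0, 1, 0, 3, ... Each value occurs along an arithmetic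
  progression, hence with positive density, while the partial sums grow at most linearly: targets
  recur often, and large ones rarely.\<close>

definition ruler :: "nat \<Rightarrow> nat" where
  "ruler k = multiplicity 2 (Suc k)"

lemma ruler_even [simp]: "ruler (2 * k) = 0"
  by (simp add: ruler_def not_dvd_imp_multiplicity_0)

lemma ruler_odd [simp]: "ruler (Suc (2 * k)) = Suc (ruler k)"
  using multiplicity_times_same[of "Suc k" "2::nat"] by (simp add: ruler_def)

text \<open>Even indices contribute 0 and the index 2l+1 contributes \<open>Suc (ruler l)\<close>,
  so the sum over 2m indices is m plus the sum over m indices.\<close>

lemma sum_ruler_le: "(\<Sum>l<k. ruler l) \<le> k"
proof (induction k rule: less_induct)
  case (less k)
  have double: "(\<Sum>l<2 * m. ruler l) = m + (\<Sum>l<m. ruler l)" for m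
    by (induction m) simp_all
  consider m where "k = 2 * m" | m where "k = Suc (2 * m)"
    by (metis evenE oddE Suc_eq_plus1)
  then show ?case
  proof cases
    case 1
    then show ?thesis using less[of m] by (cases "m = 0") (auto simp: double)
  next
    case 2
    then show ?thesis using less[of m] by (auto simp: double)
  qed
qed

lemma ruler_progression: "ruler (2 ^ i * (2 * m + 1) - 1) = i"
proof (induction i)
  case 0
  then show ?case by simp
next
  case (Suc i)
  have "0 < 2 ^ i * (2 * m + 1)" by simp
  then have "2 ^ Suc i * (2 * m + 1) - 1 = Suc (2 * (2 ^ i * (2 * m + 1) - 1))"
    unfolding power_Suc mult.assoc by linarith
  then show ?case by (simp only: ruler_odd Suc.IH)
qed

text \<open>Comparison with the harmonic series along the progression on which \<open>ruler\<close>
  equals \<open>i\<close>.\<close>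

lemma ruler_level_not_summable:
  assumes c: "0 < c"
  shows "\<not> (\<forall>N. (\<Sum>k | k < N \<and> K \<le> k \<and> ruler k = i. c / (2 * real k + 1)) \<le> M)"
proof
  assume M: "\<forall>N. (\<Sum>k | k < N \<and> K \<le> k \<and> ruler k = i. c / (2 * real k + 1)) \<le> M"
  \<comment> \<open>The members of level \<open>i\<close>, started at offset \<open>K\<close> so
    that all of them are at least \<open>K\<close>.\<close>
  define \<kappa> where "\<kappa> m = (2::nat) ^ i * (2 * (m + K) + 1) - 1" for m
  have \<kappa>Suc: "Suc (\<kappa> m) = 2 ^ i * (2 * (m + K) + 1)" for m
    by (simp add: \<kappa>_def)
  have \<kappa>_mono: "\<kappa> m < \<kappa> n" if "m < n" for m n
  proof -
    have "Suc (\<kappa> m) < Suc (\<kappa> n)" unfolding \<kappa>Suc using that by simp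
    then show ?thesis by simp
  qed
  have \<kappa>K: "K \<le> \<kappa> m" for m
  proof -
    have "1 * (2 * (m + K) + 1) \<le> 2 ^ i * (2 * (m + K) + 1)"
      by (intro mult_right_mono) auto
    then show ?thesis by (simp add: \<kappa>_def)
  qed
  have \<kappa>i: "ruler (\<kappa> m) = i" for m unfolding \<kappa>_def by (rule ruler_progression)
  have inj: "inj_on \<kappa> S" for S
    by (metis \<kappa>_mono inj_onI linorder_neqE_nat less_irrefl)
  \<comment> \<open>The power matches the estimate \<open>2 * real (\<kappa> m) + 1 \<le> 2 ^ (i +
    2) * real (Suc (m + K))\<close>.\<close>
  define q where "q = c / 2 ^ (i + 2)"
  have q: "q > 0" using c by (simp add: q_def)
  have bound: "q * inverse (real (Suc (m + K))) \<le> c / (2 * real (\<kappa> m) + 1)" for m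
  proof -
    have "real (Suc (\<kappa> m)) = 2 ^ i * (2 * (real m + real K) + 1)"
      unfolding \<kappa>Suc by (simp add: algebra_simps)
    then have "2 * real (\<kappa> m) + 1 \<le> 2 ^ i * (4 * (real m + real K) + 2)"
      by (simp add: algebra_simps)
    also have "\<dots> \<le> 2 ^ i * (4 * real (Suc (m + K)))"
      by (intro mult_left_mono) auto
    also have "\<dots> = 2 ^ (i + 2) * real (Suc (m + K))" by (simp add: power_add)
    finally have le: "2 * real (\<kappa> m) + 1 \<le> 2 ^ (i + 2) * real (Suc (m + K))" .
    have "q * inverse (real (Suc (m + K))) = c / (2 ^ (i + 2) * real (Suc (m + K)))"
      by (simp add: q_def field_simps)
    also have "\<dots> \<le> c / (2 * real (\<kappa> m) + 1)"
      using le c by (intro divide_left_mono) auto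
    finally show ?thesis .
  qed
  have "(\<Sum>m<n. q * inverse (real (Suc (m + K)))) \<le> M" for n
  proof -
    have "(\<Sum>m<n. q * inverse (real (Suc (m + K)))) \<le> (\<Sum>m<n. c / (2 * real (\<kappa> m) + 1))"
      by (intro sum_mono bound)
    also have "\<dots> = (\<Sum>k\<in>\<kappa> ` {..<n}. c / (2 * real k + 1))"
      by (simp add: sum.reindex[OF inj])
    also have "\<dots> \<le> (\<Sum>k | k < \<kappa> n \<and> K \<le> k \<and> ruler k = i. c / (2 * real k + 1))"
      using c \<kappa>K \<kappa>_mono \<kappa>i by (intro sum_mono2) auto
    also have "\<dots> \<le> M" using M by blast
    finally show ?thesis .
  qed
  then have "summable (\<lambda>m. q * inverse (real (Suc (m + K))))"
    using q by (intro summableI_nonneg_bounded[of _ M]) auto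
  then have "summable (\<lambda>m. inverse (real (Suc (m + K))))"
    using q by simp
  then have "summable (\<lambda>m. inverse (real (Suc m)))"
    using summable_iff_shift[of "\<lambda>m. inverse (real (Suc m))" K] by simp
  then show False
    using not_summable_harmonic[where 'a = real] summable_Suc_iff[of "\<lambda>n. inverse (real n)"] by (simp add: inverse_eq_divide)
qed

section \<open>Bessel's inequality for almost orthogonal sequences\<close>

context real_hilbert_form
begin

text \<open>The numbers \<open>\<gamma> k\<close> stand for the values at \<open>v k\<close> of a
  functional of norm at most \<open>C\<close>. They are given as a sequence because the functional
  will live on another space, with \<open>v k\<close> only the image of its argument. Inner products
  decaying this fast add at most \<open>2 * C\<^sup>2\<close> to the squared norm of the test
  combination.\<close>

lemma almost_orthogonal_bessel:
  fixes v :: "nat \<Rightarrow> 'h" and \<gamma> s :: "nat \<Rightarrow> real"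
  assumes s1: "\<And>k. 1 \<le> s k" and vs: "\<And>k. (norm (v k))\<^sup>2 \<le> s k"
    and vo: "\<And>k m. k < m \<Longrightarrow> \<bar>b (v k) (v m)\<bar> \<le> (1/2) ^ m / (2 * Suc m)"
    and \<gamma>: "\<And>c N. \<bar>\<Sum>k<N. c k * \<gamma> k\<bar> \<le> C * norm (\<Sum>k<N. c k *\<^sub>R v k)" and C: "0 \<le> C"
  shows "(\<Sum>k | k < N \<and> k \<in> S. (\<gamma> k)\<^sup>2 / s k) \<le> 2 * C\<^sup>2"
proof -
  \<comment> \<open>With these coefficients the functional takes the value \<open>Q\<close>, and the
    diagonal part of the squared norm is \<open>Q\<close> as well.\<close>
  define c where "c k = (if k \<in> S then \<gamma> k / s k else 0)" for k
  have \<gamma>1: "\<bar>\<gamma> k\<bar> \<le> C * norm (v k)" for k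
    using \<gamma>[of "\<lambda>j. if j = k then 1 else 0" "Suc k"]
    by (simp add: if_distrib[of "\<lambda>x. x * _"] if_distrib[of "\<lambda>x. x *\<^sub>R _"] cong: if_cong)
  have cC: "\<bar>c k\<bar> \<le> C" for k
  proof -
    have "s k \<le> (s k)\<^sup>2" using s1[of k] by (simp add: power2_eq_square)
    with vs[of k] have "(norm (v k))\<^sup>2 \<le> (s k)\<^sup>2" by (rule order_trans)
    then have "norm (v k) \<le> s k" by (rule power2_le_imp_le) (use s1[of k] in linarith)
    then have "\<bar>\<gamma> k\<bar> \<le> C * s k"
      by (intro order_trans[OF \<gamma>1] mult_left_mono C)
    then show ?thesis using s1[of k] C by (simp add: c_def field_simps)
  qed
  have norm_sum: "(norm (\<Sum>k<N. c k *\<^sub>R v k))\<^sup>2 \<le> (\<Sum>k<N. (c k)\<^sup>2 * s k) + C\<^sup>2 * (\<Sum>m<N. (1/2) ^ m)" for N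
  proof (induction N)
    case 0
    then show ?case by simp
  next
    case (Suc N)
    let ?x = "\<Sum>k<N. c k *\<^sub>R v k"
    have "\<bar>b ?x (v N)\<bar> \<le> (\<Sum>k<N. \<bar>c k * b (v k) (v N)\<bar>)"
      by (simp add: b.sum_left b.scaleR_left)
    \<comment> \<open>The factor \<open>1 / (2 * Suc N)\<close> in \<open>vo\<close> absorbs the
      number \<open>N\<close> of earlier vectors.\<close>
    also have "\<dots> \<le> (\<Sum>k<N. C * ((1/2) ^ N / (2 * Suc N)))"
      unfolding abs_mult using cC vo C by (intro sum_mono mult_mono) auto
    also have "\<dots> = (real N / Suc N) * (C * (1/2) ^ N / 2)"
      by (simp add: mult_ac)
    also have "\<dots> \<le> 1 * (C * (1/2) ^ N / 2)"
      using C by (intro mult_right_mono) auto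
    also have "\<dots> = C * (1/2) ^ N / 2" by simp
    finally have x: "\<bar>b ?x (v N)\<bar> \<le> C * (1/2) ^ N / 2" .
    have "2 * c N * b ?x (v N) \<le> 2 * (\<bar>c N\<bar> * \<bar>b ?x (v N)\<bar>)"
      by (simp add: abs_mult[symmetric])
    also have "\<dots> \<le> 2 * (C * (C * (1/2) ^ N / 2))"
      using cC[of N] x C by (intro mult_left_mono mult_mono) auto
    finally have cross: "2 * c N * b ?x (v N) \<le> C\<^sup>2 * (1/2) ^ N" by (simp add: power2_eq_square)
    have "(norm (?x + c N *\<^sub>R v N))\<^sup>2 = (norm ?x)\<^sup>2 + 2 * c N * b ?x (v N) + (c N)\<^sup>2 * (norm (v N))\<^sup>2"
      unfolding b_norm[symmetric] b.add_left b.add_right b.scaleR_left b.scaleR_right b_sym[of "v N" ?x]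
      by (simp add: power2_eq_square algebra_simps)
    moreover have "(c N)\<^sup>2 * (norm (v N))\<^sup>2 \<le> (c N)\<^sup>2 * s N" using vs by (intro mult_left_mono) auto
    ultimately show ?case using Suc.IH cross by (simp add: algebra_simps)
  qed
  have geom: "(\<Sum>m<N. (1/2) ^ m) \<le> (2::real)" for N
    by (simp add: sum_gp_strict)
  have s_nz: "s k \<noteq> 0" for k using s1[of k] by auto
  define Q where "Q = (\<Sum>k<N. (c k)\<^sup>2 * s k)"
  have "Q = (\<Sum>k<N. if k \<in> S then (\<gamma> k)\<^sup>2 / s k else 0)"
    unfolding Q_def by (intro sum.cong refl) (simp add: c_def power2_eq_square s_nz)
  also have "\<dots> = (\<Sum>k | k < N \<and> k \<in> S. (\<gamma> k)\<^sup>2 / s k)"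
    by (simp add: sum.inter_filter[symmetric])
  finally have Q: "(\<Sum>k | k < N \<and> k \<in> S. (\<gamma> k)\<^sup>2 / s k) = Q" by simp
  have "Q = (\<Sum>k<N. c k * \<gamma> k)"
    unfolding Q_def by (intro sum.cong refl) (simp add: c_def power2_eq_square s_nz)
  then have "\<bar>Q\<bar> \<le> C * norm (\<Sum>k<N. c k *\<^sub>R v k)" using \<gamma> by simp
  then have "Q\<^sup>2 \<le> (C * norm (\<Sum>k<N. c k *\<^sub>R v k))\<^sup>2"
    using power_mono[of "\<bar>Q\<bar>" _ 2] by simp
  also have "\<dots> \<le> C\<^sup>2 * (Q + C\<^sup>2 * 2)"
    unfolding power_mult_distrib Q_def
    by (intro mult_left_mono order_trans[OF norm_sum] add_mono geom order_refl) auto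
  finally have main: "Q\<^sup>2 \<le> C\<^sup>2 * (Q + C\<^sup>2 * 2)" .
  have "Q \<le> 2 * C\<^sup>2"
  proof (rule ccontr)
    assume "\<not> ?thesis"
    then have gt: "2 * C\<^sup>2 < Q" by simp
    then have "Q > 0" using zero_le_power2[of C] by linarith
    then have "2 * C\<^sup>2 * Q < Q\<^sup>2" using gt by (simp add: power2_eq_square)
    moreover have "C\<^sup>2 * (C\<^sup>2 * 2) \<le> C\<^sup>2 * Q" using gt by (intro mult_left_mono) auto
    ultimately show False using main by (simp add: algebra_simps)
  qed
  then show ?thesis by (simp add: Q)
qed

text \<open>Otherwise the squares of the \<open>\<gamma> k\<close> sum to at least
  \<open>e\<^sup>2\<close> at every late index of the level. Divided by 2k+1 and summed over k, they
  stay bounded by the Bessel estimate, whereas the lower bound diverges.\<close>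

lemma small_on_ruler_level:
  fixes v :: "nat \<Rightarrow> 'h" and \<Gamma> :: "(nat \<Rightarrow> real) set"
  assumes vs: "\<And>k. (norm (v k))\<^sup>2 \<le> 2 * real k + 1"
    and vo: "\<And>k m. k < m \<Longrightarrow> \<bar>b (v k) (v m)\<bar> \<le> (1/2) ^ m / (2 * Suc m)"
    and fin: "finite \<Gamma>"
    and \<Gamma>: "\<And>\<gamma>. \<gamma> \<in> \<Gamma> \<Longrightarrow> \<exists>C\<ge>0. \<forall>c N. \<bar>\<Sum>k<N. c k * \<gamma> k\<bar> \<le> C * norm (\<Sum>k<N. c k *\<^sub>R v k)"
    and e: "0 < e"
  shows "\<exists>k\<ge>K. ruler k = i \<and> (\<forall>\<gamma>\<in>\<Gamma>. \<bar>\<gamma> k\<bar> < e)"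
proof (rule ccontr)
  assume neg: "\<not> ?thesis"
  have low: "e\<^sup>2 \<le> (\<Sum>\<gamma>\<in>\<Gamma>. (\<gamma> k)\<^sup>2)" if k: "k \<ge> K" "ruler k = i" for k
  proof -
    obtain \<gamma> where g: "\<gamma> \<in> \<Gamma>" "e \<le> \<bar>\<gamma> k\<bar>" using neg k by (auto simp: not_less)
    have "e\<^sup>2 \<le> (\<gamma> k)\<^sup>2" using g e by (metis abs_le_square_iff abs_of_pos)
    also have "\<dots> \<le> (\<Sum>\<gamma>\<in>\<Gamma>. (\<gamma> k)\<^sup>2)" using g fin by (intro member_le_sum) auto
    finally show ?thesis .
  qed
  obtain C where C: "\<And>\<gamma>. \<gamma> \<in> \<Gamma> \<Longrightarrow> 0 \<le> C \<gamma>"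
    "\<And>\<gamma> c N. \<gamma> \<in> \<Gamma> \<Longrightarrow> \<bar>\<Sum>k<N. c k * \<gamma> k\<bar> \<le> C \<gamma> * norm (\<Sum>k<N. c k *\<^sub>R v k)"
    using \<Gamma> by metis
  have "(\<Sum>k | k < N \<and> K \<le> k \<and> ruler k = i. e\<^sup>2 / (2 * real k + 1)) \<le> (\<Sum>\<gamma>\<in>\<Gamma>. 2 * (C \<gamma>)\<^sup>2)" for N
  proof -
    have "(\<Sum>k | k < N \<and> K \<le> k \<and> ruler k = i. e\<^sup>2 / (2 * real k + 1))
        \<le> (\<Sum>k | k < N \<and> K \<le> k \<and> ruler k = i. \<Sum>\<gamma>\<in>\<Gamma>. (\<gamma> k)\<^sup>2 / (2 * real k + 1))"
      using low by (intro sum_mono) (simp add: sum_divide_distrib[symmetric] divide_right_mono)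
    also have "\<dots> = (\<Sum>\<gamma>\<in>\<Gamma>. \<Sum>k | k < N \<and> k \<in> {k. K \<le> k \<and> ruler k = i}. (\<gamma> k)\<^sup>2 / (2 * real k + 1))"
      by (subst sum.swap) simp
    also have "\<dots> \<le> (\<Sum>\<gamma>\<in>\<Gamma>. 2 * (C \<gamma>)\<^sup>2)"
      by (intro sum_mono almost_orthogonal_bessel[OF _ vs vo]) (auto simp: C)
    finally show ?thesis .
  qed
  then show False using ruler_level_not_summable[of "e\<^sup>2" K i] e by auto
qed

end

subsection \<open>A weakly dense orbit\<close>

text \<open>Take x to be the sum of \<open>\<beta> l (n l)\<close> with \<open>n l\<close> the sum
  of the first \<open>l\<close> gaps. The \<open>n k\<close>-th iterate sends the term l = k to
  \<open>y k\<close>, the terms l < k together to \<open>z k\<close>, and a term l > k to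
  \<open>\<beta> l (n l - n k)\<close>, of norm at most 1/2^l; the tail adds up to at most
  1/2^k.\<close>

lemma orbit_through_perturbed_targets:
  fixes T :: "'a::banach \<Rightarrow> 'a" and y z :: "nat \<Rightarrow> 'a" and \<beta> :: "nat \<Rightarrow> nat \<Rightarrow> 'a"
  assumes T: "bounded_linear T"
    and bwd: "\<And>k. backward_orbit T (y k) (\<beta> k)"
    and small: "\<And>k j. P k \<le> j \<Longrightarrow> norm (\<beta> k j) \<le> (1/2) ^ k"
    and p: "\<And>k. P (Suc k) \<le> p k"
    and z0: "z 0 = 0" and z: "\<And>k. z (Suc k) = (T ^^ p k) (z k + y k)"
  shows "\<exists>x. \<forall>k. norm ((T ^^ (\<Sum>l<k. p l)) x - (z k + y k)) \<le> (1/2) ^ k"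
proof -
  define n where "n k = (\<Sum>l<k. p l)" for k
  have n_Suc: "n (Suc k) = n k + p k" for k by (simp add: n_def)
  \<comment> \<open>For k < l the difference contains the last gap \<open>p (l - 1)\<close>, which
    is at least \<open>P l\<close>.\<close>
  have n_gap: "P l \<le> n l - n k" "n k \<le> n l" if kl: "k < l" for k l
  proof -
    obtain l' where l: "l = Suc l'" "k \<le> l'" using kl by (cases l) auto
    have "n k \<le> n l'" unfolding n_def using l(2) by (intro sum_mono2) auto
    then show "P l \<le> n l - n k" "n k \<le> n l" using p[of l'] by (auto simp: l n_Suc)
  qed
  have Tm: "bounded_linear (T ^^ m)" for m
  proof (induction m)
    case 0
    then show ?case by (simp add: id_def)
  next
    case (Suc m)
    then show ?case using bounded_linear_compose[OF T Suc.IH] by (simp add: o_def)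
  qed
  have T\<beta>: "(T ^^ m) (\<beta> k (m + j)) = \<beta> k j" for m k j
  proof (induction m arbitrary: j)
    case (Suc m)
    have "(T ^^ Suc m) (\<beta> k (Suc m + j)) = T ((T ^^ m) (\<beta> k (m + Suc j)))" by simp
    also have "\<dots> = T (\<beta> k (Suc j))" by (simp only: Suc.IH)
    also have "\<dots> = \<beta> k j" using bwd[of k] by (simp add: backward_orbit_def)
    finally show ?case .
  qed simp
  define u where "u k = \<beta> k (n k)" for k
  have Tu_eq: "(T ^^ n k) (u k) = y k" for k
    using T\<beta>[of "n k" k 0] bwd[of k] by (simp add: u_def backward_orbit_def)
  have Tu_gt: "norm ((T ^^ n k) (u l)) \<le> (1/2) ^ l" if "k < l" for k l
  proof -
    have "(T ^^ n k) (u l) = \<beta> l (n l - n k)"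
      using T\<beta>[of "n k" l "n l - n k"] n_gap[OF that] by (simp add: u_def)
    then show ?thesis using small n_gap[OF that] by simp
  qed
  have Tu_lt: "(\<Sum>l<k. (T ^^ n k) (u l)) = z k" for k
  proof (induction k)
    case 0
    then show ?case by (simp add: z0)
  next
    case (Suc k)
    have eq: "(T ^^ n (Suc k)) x = (T ^^ p k) ((T ^^ n k) x)" for x
      by (simp add: n_Suc add.commute[of "n k"] funpow_add)
    have "(\<Sum>l<Suc k. (T ^^ n (Suc k)) (u l)) = (T ^^ p k) (\<Sum>l<Suc k. (T ^^ n k) (u l))"
      unfolding eq by (simp add: linear_sum[OF bounded_linear.linear[OF Tm]] linear_add[OF bounded_linear.linear[OF Tm]])
    also have "\<dots> = z (Suc k)" by (simp add: Suc.IH Tu_eq z)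
    finally show ?case .
  qed
  have geo: "summable (\<lambda>k. (1/2::real) ^ k)" by (simp add: summable_geometric)
  have "summable u"
  \<comment> \<open>The estimate starts at index 1: the initial term \<open>u 0\<close> is
    \<open>y 0\<close> itself and may be large.\<close>
  proof (rule summable_comparison_test'[OF geo])
    show "norm (u k) \<le> (1/2) ^ k" if "k \<ge> 1" for k
      using Tu_gt[of 0 k] that by (simp add: n_def)
  qed
  have "norm ((T ^^ n k) (\<Sum>l. u l) - (z k + y k)) \<le> (1/2) ^ k" for k
  proof -
    have sm: "summable (\<lambda>l. (T ^^ n k) (u l))"
      using bounded_linear.summable[OF Tm \<open>summable u\<close>] .
    have "(T ^^ n k) (\<Sum>l. u l) = (\<Sum>l. (T ^^ n k) (u l))"
      using bounded_linear.suminf[OF Tm \<open>summable u\<close>] .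
    also have "\<dots> = (\<Sum>l. (T ^^ n k) (u (l + Suc k))) + (\<Sum>l<Suc k. (T ^^ n k) (u l))"
      by (rule suminf_split_initial_segment[OF sm])
    also have "(\<Sum>l<Suc k. (T ^^ n k) (u l)) = z k + y k" by (simp add: Tu_lt Tu_eq)
    finally have "(T ^^ n k) (\<Sum>l. u l) - (z k + y k) = (\<Sum>l. (T ^^ n k) (u (l + Suc k)))" by simp
    also have "norm \<dots> \<le> (\<Sum>l. (1/2) ^ (l + Suc k))"
    proof (rule norm_suminf_le)
      show "norm ((T ^^ n k) (u (l + Suc k))) \<le> (1/2) ^ (l + Suc k)" for l
        by (rule Tu_gt) simp
      show "summable (\<lambda>l. (1/2::real) ^ (l + Suc k))" using geo summable_ignore_initial_segment by blast
    qed
    also have "\<dots> = (\<Sum>l. (1/2) ^ l * (1/2) ^ Suc k)" by (simp only: power_add)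
    also have "\<dots> = (1/2) ^ k"
      using suminf_mult2[OF geo, of "(1/2) ^ Suc k"] by (simp add: suminf_geometric)
    finally show ?thesis .
  qed
  then show ?thesis unfolding n_def by blast
qed

text \<open>The targets must lie in \<open>F\<close>, so each point of the countable dense set is
  replaced by points of \<open>F\<close> approximating it.\<close>

lemma dense_sequence_in_dense_subset:
  fixes F D0 :: "'a::metric_space set"
  assumes D0: "countable D0" "closure D0 = UNIV" and F: "closure F = UNIV"
  obtains D :: "nat \<Rightarrow> 'a" where "range D \<subseteq> F" "\<And>x e. 0 < e \<Longrightarrow> \<exists>m. dist (D m) x < e"
proof -
  have "\<exists>y\<in>F. dist y d < inverse (Suc n)" for d n
    using F closure_approachable[of d F] by (metis UNIV_I inverse_Suc)
  then obtain \<phi> where \<phi>: "\<And>d n. \<phi> d n \<in> F" "\<And>d n. dist (\<phi> d n) d < inverse (Suc n)"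
    by metis
  define S where "S = (\<lambda>(d, n). \<phi> d n) ` (D0 \<times> UNIV)"
  have "countable S" unfolding S_def using D0 by auto
  moreover have "D0 \<noteq> {}" using D0 by auto
  then have "S \<noteq> {}" by (auto simp: S_def)
  ultimately have range: "range (from_nat_into S) = S" by (rule range_from_nat_into[rotated])
  have "\<exists>m. dist (from_nat_into S m) x < e" if e: "0 < e" for x e
  proof -
    obtain d where d: "d \<in> D0" "dist d x < e / 2"
      using D0(2) closure_approachable[of x D0] e by (metis UNIV_I half_gt_zero)
    obtain n where n: "inverse (real (Suc n)) < e / 2"
      using reals_Archimedean[of "e / 2"] e by auto
    have "dist (\<phi> d n) x < e"
      using dist_triangle[of "\<phi> d n" x d] \<phi>(2)[of d n] d n by linarith
    moreover have "\<phi> d n \<in> range (from_nat_into S)" unfolding range using d by (auto simp: S_def)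
    ultimately show ?thesis by auto
  qed
  moreover have "range (from_nat_into S) \<subseteq> F" unfolding range using \<phi> by (auto simp: S_def)
  ultimately show thesis using that by blast
qed

context real_hilbert_form
begin

text \<open>By \<open>\<iota>_bound\<close> every bounded functional on the Banach space is bounded
  in the Hilbert norm on combinations of the perturbations \<open>z k\<close>. Hence
  \<open>small_on_ruler_level\<close> makes finitely many functionals small at some
  \<open>z k\<close> whose target \<open>y k\<close> is a prescribed \<open>D m\<close>.\<close>

lemma weakly_dense_orbit:
  fixes T :: "'a::banach \<Rightarrow> 'a" and \<iota> :: "'a \<Rightarrow> 'h" and V :: "'h \<Rightarrow> 'h" and D :: "nat \<Rightarrow> 'a"
  assumes T: "bounded_linear T" and F: "subspace F" and TF: "T ` F \<subseteq> F"
    and \<iota>_add: "\<And>x y. x \<in> F \<Longrightarrow> y \<in> F \<Longrightarrow> \<iota> (x + y) = \<iota> x + \<iota> y"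
    and \<iota>_scale: "\<And>r x. x \<in> F \<Longrightarrow> \<iota> (r *\<^sub>R x) = r *\<^sub>R \<iota> x"
    and \<iota>_bound: "\<And>x. x \<in> F \<Longrightarrow> norm x \<le> M * norm (\<iota> x)"
    and V: "linear V" "\<And>h. norm (V h) = norm h"
    and nofin: "\<And>B. finite B \<Longrightarrow> V ` span B \<subseteq> span B \<Longrightarrow> span B = {0}"
    and V\<iota>: "\<And>x. x \<in> F \<Longrightarrow> V (\<iota> x) = \<iota> (T x)"
    and bwd: "\<And>x. x \<in> F \<Longrightarrow> \<exists>xs. backward_orbit T x xs \<and> xs \<longlonglongrightarrow> 0"
    and D: "range D \<subseteq> F" "\<And>x e. 0 < e \<Longrightarrow> \<exists>m. dist (D m) x < e"
  shows "\<exists>x. \<forall>x0 \<Psi> e. finite \<Psi> \<and> (\<forall>g\<in>\<Psi>. bounded_linear g) \<and> 0 < e \<longrightarrow>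
    (\<exists>n. \<forall>g\<in>\<Psi>. \<bar>g ((T ^^ n) x) - g x0\<bar> < (e::real))"
proof -
  have F0: "0 \<in> F" using F by (rule subspace_0)
  have \<iota>0: "\<iota> 0 = 0" using \<iota>_scale[OF F0, of 0] by simp
  have TmF: "(T ^^ m) x \<in> F" if "x \<in> F" for m x
    using that TF by (induction m) auto
  have Vm\<iota>: "(V ^^ m) (\<iota> x) = \<iota> ((T ^^ m) x)" if "x \<in> F" for m x
    using that by (induction m) (auto simp: V\<iota> TmF)
  have Vm_norm: "norm ((V ^^ m) h) = norm h" for m h
    by (induction m) (auto simp: V(2))
  have \<iota>_sum: "(\<Sum>k<N. c k *\<^sub>R z k) \<in> F \<and> \<iota> (\<Sum>k<N. c k *\<^sub>R z k) = (\<Sum>k<N. c k *\<^sub>R \<iota> (z k))"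
    if z: "\<And>k. z k \<in> F" for z :: "nat \<Rightarrow> 'a" and c N
    by (induction N)
       (auto simp: F0 \<iota>0 \<iota>_add \<iota>_scale z subspace_add[OF F] subspace_scale[OF F])
  \<comment> \<open>The level encodes a pair: which target to use, and a second number that makes
    the level as large as desired. A target of squared norm above its level is replaced by 0, which
    keeps the squared norms below \<open>ruler k\<close>.\<close>
  define y where "y k = (let m = fst (prod_decode (ruler k))
    in if (norm (\<iota> (D m)))\<^sup>2 \<le> real (ruler k) then D m else 0)" for k
  have yF: "y k \<in> F" for k using D(1) F0 by (auto simp: y_def Let_def)
  have y_norm: "(norm (\<iota> (y k)))\<^sup>2 \<le> real (ruler k)" for k
    by (auto simp: y_def Let_def \<iota>0)
  have y_level: "\<exists>i. \<forall>k. ruler k = i \<longrightarrow> y k = D m" for m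
  proof -
    obtain j :: nat where "(norm (\<iota> (D m)))\<^sup>2 \<le> real j" using real_arch_simple by blast
    also have "real j \<le> real (prod_encode (m, j))" by (simp add: le_prod_encode_2)
    finally show ?thesis by (intro exI[of _ "prod_encode (m, j)"]) (auto simp: y_def)
  qed
  have "\<exists>xs. backward_orbit T (y k) xs \<and> xs \<longlonglongrightarrow> 0" for k using bwd yF by blast
  then obtain \<beta> where \<beta>: "\<And>k. backward_orbit T (y k) (\<beta> k)" "\<And>k. \<beta> k \<longlonglongrightarrow> 0" by metis
  have "\<exists>P. \<forall>j\<ge>P. norm (\<beta> k j) \<le> (1/2) ^ k" for k
    using order_tendstoD(2)[OF tendsto_norm_zero[OF \<beta>(2)[of k]], of "(1/2) ^ k"]
    by (auto simp: eventually_sequentially intro: less_imp_le)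
  then obtain P where P: "\<And>k j. P k \<le> j \<Longrightarrow> norm (\<beta> k j) \<le> (1/2) ^ k" by metis
  \<comment> \<open>The decay that \<open>almost_orthogonal_bessel\<close> asks for.\<close>
  define \<delta> :: "nat \<Rightarrow> real" where "\<delta> m = (1/2) ^ m / (2 * Suc m)" for m
  \<comment> \<open>A state holds the current perturbation, the set of all earlier ones, and the
    exponent that led to it.\<close>
  define good :: "nat \<Rightarrow> 'a \<times> 'a set \<times> nat \<Rightarrow> bool"
    where "good k = (\<lambda>(z, Z, p). z \<in> F \<and> finite Z \<and> (k = 0 \<longrightarrow> z = 0))" for k
  define succ :: "nat \<Rightarrow> 'a \<times> 'a set \<times> nat \<Rightarrow> 'a \<times> 'a set \<times> nat \<Rightarrow> bool"
    where "succ k = (\<lambda>(z, Z, p) (z', Z', p'). P (Suc k) \<le> p' \<and> z' = (T ^^ p') (z + y k) \<and>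
      Z' = insert z Z \<and> (\<forall>g\<in>Z'. \<bar>b (\<iota> z') (\<iota> g)\<bar> < \<delta> (Suc k)) \<and>
      \<bar>b (\<iota> z') (\<iota> (y (Suc k)))\<bar> < 1/2)" for k
  have "\<exists>f. \<forall>k. good k (f k) \<and> succ k (f k) (f (Suc k))"
  proof (rule dependent_nat_choice)
    show "\<exists>s. good 0 s" by (intro exI[of _ "(0, {}, 0)"]) (simp add: good_def F0)
    fix s k assume s: "good k s"
    obtain z Z p where szp: "s = (z, Z, p)" by (cases s)
    have zF: "z + y k \<in> F" and finZ: "finite Z"
      using s by (auto simp: szp good_def yF subspace_add[OF F])
    have "0 < min (\<delta> (Suc k)) (1/2)" by (simp add: \<delta>_def)
    \<comment> \<open>The next perturbation is made nearly orthogonal to all previous ones and to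
      the target about to be added to it.\<close>
    from weak_mixing[OF V nofin _ this, of "\<iota> ` insert (y (Suc k)) (insert z Z)" "P (Suc k)" "\<iota> (z + y k)"]
    obtain p' where p': "P (Suc k) \<le> p'"
      and sm: "\<And>g. g \<in> insert (y (Suc k)) (insert z Z) \<Longrightarrow>
        \<bar>b (\<iota> ((T ^^ p') (z + y k))) (\<iota> g)\<bar> < min (\<delta> (Suc k)) (1/2)"
      using finZ by (auto simp: Vm\<iota>[OF zF])
    have "good (Suc k) ((T ^^ p') (z + y k), insert z Z, p')"
      using finZ TmF[OF zF] by (simp add: good_def)
    moreover have "succ k s ((T ^^ p') (z + y k), insert z Z, p')"
      using p' sm by (auto simp: succ_def szp)
    ultimately show "\<exists>s'. good (Suc k) s' \<and> succ k s s'" by blast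
  qed
  then obtain f where f: "\<And>k. good k (f k)" "\<And>k. succ k (f k) (f (Suc k))" by blast
  define z where "z k = fst (f k)" for k
  define Z where "Z k = fst (snd (f k))" for k
  \<comment> \<open>The exponent leading from state k to state k+1 is stored in the latter.\<close>
  define p where "p k = snd (snd (f (Suc k)))" for k
  have zF: "z k \<in> F" and z0: "z 0 = 0" for k
    using f(1)[of k] f(1)[of 0] by (auto simp: good_def z_def split: prod.splits)
  have step: "P (Suc k) \<le> p k" "z (Suc k) = (T ^^ p k) (z k + y k)" "Z (Suc k) = insert (z k) (Z k)"
    "\<And>g. g \<in> Z (Suc k) \<Longrightarrow> \<bar>b (\<iota> (z (Suc k))) (\<iota> g)\<bar> < \<delta> (Suc k)"
    "\<bar>b (\<iota> (z (Suc k))) (\<iota> (y (Suc k)))\<bar> < 1/2" for k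
    using f(2)[of k] by (auto simp: succ_def z_def Z_def p_def split: prod.splits)
  have zZ: "z l \<in> Z k" if "l < k" for l k
    using that by (induction k) (auto simp: step(3) less_Suc_eq)
  have z_orth: "\<bar>b (\<iota> (z k)) (\<iota> (z m))\<bar> \<le> (1/2) ^ m / (2 * Suc m)" if "k < m" for k m
  proof -
    obtain m' where m: "m = Suc m'" using \<open>k < m\<close> by (cases m) auto
    show ?thesis using step(4)[of "z k" m'] zZ[OF that] b_sym[of "\<iota> (z k)"]
      by (simp add: m \<delta>_def)
  qed
  have zy: "b (\<iota> (z k)) (\<iota> (y k)) \<le> 1/2" for k
    using step(5)[of "k - 1"] by (cases k) (auto simp: z0 \<iota>0 b.zero_left)
  \<comment> \<open>\<open>V\<close> is isometric, so a step adds only the cross term, at most 1,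
    and the squared norm of the target, at most \<open>ruler k\<close>.\<close>
  have "(norm (\<iota> (z k)))\<^sup>2 \<le> real (k + (\<Sum>l<k. ruler l))" for k
  proof (induction k)
    case 0
    then show ?case by (simp add: z0 \<iota>0)
  next
    case (Suc k)
    have "norm (\<iota> (z (Suc k))) = norm (\<iota> (z k) + \<iota> (y k))"
      unfolding step(2) using Vm\<iota>[of "z k + y k" "p k"] Vm_norm[of "p k" "\<iota> (z k + y k)"]
      by (simp add: zF yF subspace_add[OF F] \<iota>_add)
    then have "(norm (\<iota> (z (Suc k))))\<^sup>2 = (norm (\<iota> (z k)))\<^sup>2 + 2 * b (\<iota> (z k)) (\<iota> (y k)) + (norm (\<iota> (y k)))\<^sup>2"
      by (simp add: b_norm[symmetric] b.add_left b.add_right b_sym[of "\<iota> (y k)" "\<iota> (z k)"])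
    then show ?case using Suc.IH zy[of k] y_norm[of k] by simp
  qed
  moreover have "real (k + (\<Sum>l<k. ruler l)) \<le> 2 * real k + 1" for k
    using sum_ruler_le[of k] by linarith
  ultimately have z_norm: "(norm (\<iota> (z k)))\<^sup>2 \<le> 2 * real k + 1" for k
    by (rule order_trans)
  obtain x where x: "\<And>k. norm ((T ^^ (\<Sum>l<k. p l)) x - (z k + y k)) \<le> (1/2) ^ k"
    using orbit_through_perturbed_targets[where P = P and p = p and y = y and z = z, OF T \<beta>(1) P step(1) z0 step(2)] by blast
  have "\<exists>n. \<forall>g\<in>\<Psi>. \<bar>g ((T ^^ n) x) - g x0\<bar> < e"
    if fin: "finite \<Psi>" and \<Psi>: "\<And>g. g \<in> \<Psi> \<Longrightarrow> bounded_linear g" and e: "0 < e"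
    for x0 \<Psi> and e :: real
  proof -
    have "\<exists>C\<ge>0. \<forall>x. \<bar>g x\<bar> \<le> norm x * C" if "g \<in> \<Psi>" for g
      using bounded_linear.nonneg_bounded[OF \<Psi>[OF that]] by auto
    then obtain C where C: "\<And>g. g \<in> \<Psi> \<Longrightarrow> 0 \<le> C g" "\<And>g x. g \<in> \<Psi> \<Longrightarrow> \<bar>g x\<bar> \<le> norm x * C g"
      by metis
    \<comment> \<open>A common bound for all functionals; the summand 1 makes it positive, for the
      divisions below.\<close>
    define C' where "C' = 1 + (\<Sum>g\<in>\<Psi>. C g)"
    have C'_pos: "0 < C'" using C(1) by (simp add: C'_def add_pos_nonneg sum_nonneg)
    have C': "\<bar>g x\<bar> \<le> norm x * C'" if "g \<in> \<Psi>" for g x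
    proof -
      have "C g \<le> C'" using member_le_sum[OF that _ fin, of C] C(1) by (simp add: C'_def)
      then show ?thesis using C(2)[OF that, of x] mult_left_mono[of "C g" C' "norm x"] by simp
    qed
    obtain m where m: "dist (D m) x0 < e / (3 * C')" using D(2)[of "e / (3 * C')" x0] e C'_pos by auto
    obtain i where i: "\<And>k. ruler k = i \<Longrightarrow> y k = D m" using y_level by blast
    obtain K where K: "(1/2) ^ K < e / (3 * C')"
      using real_arch_pow_inv[of "e / (3 * C')" "1/2"] e C'_pos by auto
    \<comment> \<open>Level \<open>i\<close> fixes the target to be \<open>D m\<close>, and
      \<open>K\<close> controls the orbit error. The three errors of e/3 come from the orbit, from
      \<open>z k\<close>, and from \<open>D m\<close> against \<open>x0\<close>.\<close>
    have "\<exists>k\<ge>K. ruler k = i \<and> (\<forall>\<gamma>\<in>(\<lambda>g k. g (z k)) ` \<Psi>. \<bar>\<gamma> k\<bar> < e / 3)"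
    proof (rule small_on_ruler_level[of "\<lambda>k. \<iota> (z k)", OF z_norm z_orth])
      fix \<gamma> assume "\<gamma> \<in> (\<lambda>g k. g (z k)) ` \<Psi>"
      then obtain g where g: "g \<in> \<Psi>" and \<gamma>: "\<gamma> = (\<lambda>k. g (z k))" by blast
      have "\<bar>\<Sum>k<N. c k * \<gamma> k\<bar> \<le> C' * \<bar>M\<bar> * norm (\<Sum>k<N. c k *\<^sub>R \<iota> (z k))" for c N
      proof -
        let ?s = "\<Sum>k<N. c k *\<^sub>R z k"
        have lin: "linear g" using \<Psi>[OF g] by (rule bounded_linear.linear)
        have "(\<Sum>k<N. c k * \<gamma> k) = g ?s"
          by (simp add: \<gamma> linear_sum[OF lin] linear_scale[OF lin])
        then have "\<bar>\<Sum>k<N. c k * \<gamma> k\<bar> \<le> norm ?s * C'" using C'[OF g] by simp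
        also have "norm ?s \<le> M * norm (\<iota> ?s)" using \<iota>_sum zF \<iota>_bound by blast
        also have "\<dots> \<le> \<bar>M\<bar> * norm (\<iota> ?s)" by (intro mult_right_mono) auto
        also have "\<iota> ?s = (\<Sum>k<N. c k *\<^sub>R \<iota> (z k))" using \<iota>_sum zF by blast
        finally show ?thesis using C'_pos by (simp add: mult_ac)
      qed
      then show "\<exists>C\<ge>0. \<forall>c N. \<bar>\<Sum>k<N. c k * \<gamma> k\<bar> \<le> C * norm (\<Sum>k<N. c k *\<^sub>R \<iota> (z k))"
        using C'_pos by (intro exI[of _ "C' * \<bar>M\<bar>"]) auto
    qed (use fin e in auto)
    then obtain k where k: "k \<ge> K" "ruler k = i" and gz: "\<And>g. g \<in> \<Psi> \<Longrightarrow> \<bar>g (z k)\<bar> < e / 3" by auto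
    let ?n = "\<Sum>l<k. p l"
    have "\<bar>g ((T ^^ ?n) x) - g x0\<bar> < e" if g: "g \<in> \<Psi>" for g
    proof -
      have lin: "linear g" using \<Psi>[OF g] by (rule bounded_linear.linear)
      let ?t = "(T ^^ ?n) x - (z k + y k)"
      have "(1/2::real) ^ k \<le> (1/2) ^ K" using k(1) by (intro power_decreasing) auto
      then have "norm ?t < e / (3 * C')" using x[of k] K by linarith
      then have "norm ?t * C' < e / 3" using C'_pos by (simp add: field_simps)
      then have 1: "\<bar>g ?t\<bar> < e / 3" using C'[OF g] le_less_trans by blast
      have "norm (y k - x0) * C' < e / 3" using m C'_pos by (simp add: i[OF k(2)] dist_norm field_simps)
      then have 2: "\<bar>g (y k - x0)\<bar> < e / 3" using C'[OF g] le_less_trans by blast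
      have "g ((T ^^ ?n) x) - g x0 = g ?t + g (z k) + g (y k - x0)"
        by (simp add: linear_add[OF lin] linear_diff[OF lin])
      then show ?thesis using 1 2 gz[OF g] by linarith
    qed
    then show ?thesis by blast
  qed
  then show ?thesis by (intro exI[of _ x]) simp
qed

end

section \<open>Reduction of the K-linear setting to real scalars\<close>

lemma scal_of_real: "scal J (of_real r) x = r *\<^sub>R x"
  by (simp add: scal_def)

lemma scal_imaginary_unit: "scal J \<i> x = J x"
  by (simp add: scal_def)

lemma of_real_in_Kscalars: "of_real r \<in> Kscalars cplx"
  by (simp add: Kscalars_def)

lemma K_functional_bounded_linear:
  assumes "K_functional cplx J f"
  shows "bounded_linear (\<lambda>x. Re (f x))" "bounded_linear (\<lambda>x. Im (f x))"
proof -
  have add: "f (x + y) = f x + f y" for x y using assms by (simp add: K_functional_def)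
  have scale: "f (r *\<^sub>R x) = of_real r * f x" for r x
    using assms of_real_in_Kscalars[of r cplx] unfolding K_functional_def by (metis scal_of_real)
  obtain B where B: "\<And>x. cmod (f x) \<le> B * norm x" using assms unfolding K_functional_def by blast
  have "bounded_linear f"
    using B by (intro bounded_linear_intro[of f B]) (auto simp: add scale scaleR_conv_of_real mult.commute)
  then show "bounded_linear (\<lambda>x. Re (f x))" "bounded_linear (\<lambda>x. Im (f x))"
    by (auto intro: bounded_linear_compose[OF bounded_linear_Re] bounded_linear_compose[OF bounded_linear_Im])
qed

lemma K_span_invariant:
  assumes V: "linear V" and J: "cplx \<Longrightarrow> linear J" and VJ: "\<And>x. cplx \<Longrightarrow> V (J x) = J (V x)"
    and inv: "V ` span B \<subseteq> span B"
  shows "V ` K_span cplx J B \<subseteq> K_span cplx J B"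
proof (cases cplx)
  case False
  then show ?thesis using inv by (simp add: K_span_def)
next
  case True
  let ?W = "span (B \<union> J ` B)"
  have VB: "V x \<in> span B" if "x \<in> B" for x using inv span_base[OF that] by blast
  have JB: "J x \<in> ?W" if "x \<in> span B" for x
  proof -
    have "J x \<in> span (J ` B)" using linear_span_image[OF J[OF True], of B] that by blast
    then show ?thesis using span_mono[of "J ` B" "B \<union> J ` B"] by blast
  qed
  have "V ` (B \<union> J ` B) \<subseteq> ?W"
    using VB JB VJ[OF True] span_mono[of B "B \<union> J ` B"] by auto
  then have "span (V ` (B \<union> J ` B)) \<subseteq> ?W" by (simp add: span_minimal)
  then show ?thesis using True linear_span_image[OF V, of "B \<union> J ` B"] by (simp add: K_span_def)
qed

theorem theorem1p2:
  fixes cplx :: bool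
    and J :: "'a::banach \<Rightarrow> 'a"
    and T :: "'a \<Rightarrow> 'a"
    and F :: "'a set"
    and ip :: "'a \<Rightarrow> 'a \<Rightarrow> complex"
  assumes X_K_space: "K_normed_space cplx J"
    and separable: "\<exists>D::'a set. countable D \<and> closure D = UNIV"
    and infdim: "K_infinite_dimensional cplx J"
    and T_bounded: "bounded_linear T"
    and T_K_linear: "K_linear cplx J T"
    and F_subspace: "K_subspace cplx J F"
    and F_dense: "closure F = UNIV"
    and F_invariant: "T ` F \<subseteq> F"
    and B1_ip: "K_inner_product cplx J F ip"
    and B1_stronger: "\<forall>x\<in>F. \<forall>e>0. \<exists>d>0. \<forall>y\<in>F.
                        ip_norm ip (y - x) < d \<longrightarrow> norm (y - x) < e"
    and B2: "\<exists>(JH :: 'h::banach \<Rightarrow> 'h) ipH \<iota> V.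
               hilbert_completion cplx J F ip JH ipH \<iota> \<and>
               continuous_on UNIV V \<and>
               (\<forall>x\<in>F. V (\<iota> x) = \<iota> (T x)) \<and>
               (\<forall>h. norm (V h) = norm h) \<and>
               (\<forall>B. finite B \<and> V ` K_span cplx JH B \<subseteq> K_span cplx JH B
                      \<longrightarrow> K_span cplx JH B = {0})"
    and B3: "\<forall>x\<in>F. \<exists>xs. backward_orbit T x xs \<and> xs \<longlonglongrightarrow> 0"
  shows "weakly_hypercyclic cplx J T"
proof -
  obtain JH :: "'h \<Rightarrow> 'h" and ipH \<iota> V where hc: "hilbert_completion cplx J F ip JH ipH \<iota>"
    and V_cont: "continuous_on UNIV V" and V\<iota>: "\<And>x. x \<in> F \<Longrightarrow> V (\<iota> x) = \<iota> (T x)"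
    and V_iso: "\<And>h. norm (V h) = norm h"
    and V_inv: "\<And>B. finite B \<Longrightarrow> V ` K_span cplx JH B \<subseteq> K_span cplx JH B \<Longrightarrow> K_span cplx JH B = {0}"
    using B2 by metis
  have H: "K_normed_space cplx JH" and ipH: "K_inner_product cplx JH UNIV ipH"
    and H_norm: "\<And>h. norm h = ip_norm ipH h"
    and \<iota>_add: "\<And>x y. x \<in> F \<Longrightarrow> y \<in> F \<Longrightarrow> \<iota> (x + y) = \<iota> x + \<iota> y"
    and \<iota>_scal: "\<And>c x. c \<in> Kscalars cplx \<Longrightarrow> x \<in> F \<Longrightarrow> \<iota> (scal J c x) = scal JH c (\<iota> x)"
    and \<iota>_ip: "\<And>x y. x \<in> F \<Longrightarrow> y \<in> F \<Longrightarrow> ipH (\<iota> x) (\<iota> y) = ip x y"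
    and \<iota>_dense: "closure (\<iota> ` F) = UNIV"
    using hc by (auto simp: hilbert_completion_def)
  have F: "subspace F" and FJ: "\<And>x. cplx \<Longrightarrow> x \<in> F \<Longrightarrow> J x \<in> F"
    using F_subspace by (auto simp: K_subspace_def)
  have linT: "linear T" using T_bounded by (rule bounded_linear.linear)
  have TF: "T x \<in> F" if "x \<in> F" for x using F_invariant that by blast
  have \<iota>_scale: "\<iota> (r *\<^sub>R x) = r *\<^sub>R \<iota> x" if "x \<in> F" for r x
    using \<iota>_scal[OF of_real_in_Kscalars that, of r] by (simp add: scal_of_real)
  note ipH' = ipH[unfolded K_inner_product_def, THEN conjunct2]
  note ipH_sym = ipH'[THEN conjunct1, rule_format, OF UNIV_I UNIV_I]
  note ipH_add = ipH'[THEN conjunct2, THEN conjunct1, rule_format, OF UNIV_I UNIV_I UNIV_I]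
  note ipH_scal = ipH'[THEN conjunct2, THEN conjunct2, THEN conjunct1, rule_format, OF _ UNIV_I UNIV_I]
  note ipH_nonneg = ipH'[THEN conjunct2, THEN conjunct2, THEN conjunct2, THEN conjunct1, rule_format, OF UNIV_I]
  interpret real_hilbert_form "\<lambda>x y. Re (ipH x y)"
  proof
    show "Re (ipH (x + y) z) = Re (ipH x z) + Re (ipH y z)" for x y z
      by (simp add: ipH_add)
    show "Re (ipH (r *\<^sub>R x) y) = r * Re (ipH x y)" for r x y
      using ipH_scal[OF of_real_in_Kscalars, of r x y] by (simp add: scal_of_real)
    show "Re (ipH x y) = Re (ipH y x)" for x y
      by (simp add: ipH_sym[of x y])
    show "Re (ipH x x) = (norm x)\<^sup>2" for x
      by (simp add: H_norm ip_norm_def ipH_nonneg)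
  qed
  \<comment> \<open>\<open>V\<close> is known explicitly only on the image of \<open>F\<close>. Its
    linearity, and in the complex case that it commutes with \<open>JH\<close>, pass to the
    completion by density and continuity.\<close>
  have approx: "\<exists>f. (\<forall>n. f n \<in> F) \<and> (\<lambda>n. \<iota> (f n)) \<longlonglongrightarrow> h" for h
  proof -
    have "h \<in> closure (\<iota> ` F)" by (simp add: \<iota>_dense)
    then obtain g where g: "\<And>n. g n \<in> \<iota> ` F" "g \<longlonglongrightarrow> h" unfolding closure_sequential by blast
    then have "\<exists>f. \<forall>n. f n \<in> F \<and> g n = \<iota> (f n)" by (intro choice) auto
    then show ?thesis using g(2) by (metis (no_types, lifting) ext)
  qed
  have V_lim: "(\<lambda>n. V (g n)) \<longlonglongrightarrow> V h" if "g \<longlonglongrightarrow> h" for g h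
    using continuous_on_tendsto_compose[OF V_cont that] by simp
  have V_lin: "linear V"
  proof (rule linearI)
    fix h h' :: 'h and r :: real
    obtain f where f: "\<And>n. f n \<in> F" "(\<lambda>n. \<iota> (f n)) \<longlonglongrightarrow> h" using approx by blast
    obtain g where g: "\<And>n. g n \<in> F" "(\<lambda>n. \<iota> (g n)) \<longlonglongrightarrow> h'" using approx by blast
    have "(\<lambda>n. V (\<iota> (f n) + \<iota> (g n))) = (\<lambda>n. V (\<iota> (f n)) + V (\<iota> (g n)))"
      using f(1) g(1)
      by (simp add: \<iota>_add[symmetric] V\<iota> subspace_add[OF F] linear_add[OF linT] TF)
    then show "V (h + h') = V h + V h'"
      using V_lim[OF tendsto_add[OF f(2) g(2)]] tendsto_add[OF V_lim[OF f(2)] V_lim[OF g(2)]]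
      by (simp add: LIMSEQ_unique)
    have "(\<lambda>n. V (r *\<^sub>R \<iota> (f n))) = (\<lambda>n. r *\<^sub>R V (\<iota> (f n)))"
      using f(1)
      by (simp add: \<iota>_scale[symmetric] V\<iota> subspace_scale[OF F] linear_scale[OF linT] TF)
    then show "V (r *\<^sub>R h) = r *\<^sub>R V h"
      using V_lim[OF tendsto_scaleR[OF tendsto_const f(2)], of r]
        tendsto_scaleR[OF tendsto_const V_lim[OF f(2)], of r]
      by (simp add: LIMSEQ_unique)
  qed
  have JH_lin: "linear JH" if cplx
    using H that by (simp add: K_normed_space_def)
  have V_JH: "V (JH h) = JH (V h)" if cplx for h
  proof -
    have "norm (JH x) = norm x" for x
      using H that scal_imaginary_unit[of JH x] by (metis K_normed_space_def mult_1 norm_ii)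
    then have JH: "bounded_linear JH"
      using JH_lin[OF that] by (intro bounded_linear_intro[of JH 1]) (auto simp: linear_add linear_scale)
    have \<iota>J: "\<iota> (J x) = JH (\<iota> x)" if "x \<in> F" for x
      using \<iota>_scal[of \<i> x] \<open>cplx\<close> that by (simp add: Kscalars_def scal_imaginary_unit)
    have TJ: "T (J x) = J (T x)" for x using T_K_linear that by (simp add: K_linear_def)
    obtain f where f: "\<And>n. f n \<in> F" "(\<lambda>n. \<iota> (f n)) \<longlonglongrightarrow> h" using approx by blast
    have "(\<lambda>n. V (JH (\<iota> (f n)))) = (\<lambda>n. JH (V (\<iota> (f n))))"
      using f(1) FJ[OF that] TF by (simp add: \<iota>J[symmetric] V\<iota> TJ)
    then show ?thesis
      using V_lim[OF bounded_linear.tendsto[OF JH f(2)]] bounded_linear.tendsto[OF JH V_lim[OF f(2)]]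
      by (simp add: LIMSEQ_unique)
  qed
  have nofin: "span B = {0}" if "finite B" "V ` span B \<subseteq> span B" for B
  proof -
    have "K_span cplx JH B = {0}"
      by (rule V_inv[OF that(1) K_span_invariant[where V = V and J = JH, OF V_lin JH_lin V_JH that(2)]])
    moreover have "span B \<subseteq> K_span cplx JH B" by (simp add: K_span_def span_mono)
    ultimately show ?thesis using span_0[of B] by blast
  qed
  \<comment> \<open>Continuity at 0 with tolerance 1; homogeneity then turns it into a linear
    bound.\<close>
  obtain d where d: "d > 0" and d_small: "\<And>y. y \<in> F \<Longrightarrow> norm (\<iota> y) < d \<Longrightarrow> norm y < 1"
  proof -
    have "norm (\<iota> y) = ip_norm ip y" if "y \<in> F" for y
      by (simp add: H_norm ip_norm_def \<iota>_ip[OF that that])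
    then show thesis
      using B1_stronger[rule_format, of 0 1] subspace_0[OF F] that by auto
  qed
  have \<iota>_bound: "norm x \<le> 2 / d * norm (\<iota> x)" if "x \<in> F" for x
  proof (cases "\<iota> x = 0")
    case True
    have "x = 0"
    proof (rule ccontr)
      assume "x \<noteq> 0"
      then show False
        using d_small[of "inverse (norm x) *\<^sub>R x"] d True that by (simp add: \<iota>_scale subspace_scale[OF F])
    qed
    then show ?thesis using d by simp
  next
    case False
    \<comment> \<open>The rescaled vector has image of norm d/2, strictly below \<open>d\<close>;
      hence the constant \<open>2 / d\<close>.\<close>
    have "norm ((d / (2 * norm (\<iota> x))) *\<^sub>R x) < 1"
      using False d that by (intro d_small) (simp_all add: \<iota>_scale subspace_scale[OF F])
    then show ?thesis using False d by (simp add: field_simps)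
  qed
  obtain D :: "nat \<Rightarrow> 'a" where D: "range D \<subseteq> F" "\<And>x e. 0 < e \<Longrightarrow> \<exists>m. dist (D m) x < e"
    using separable dense_sequence_in_dense_subset[OF _ _ F_dense] by metis
  have bwd: "\<exists>xs. backward_orbit T x xs \<and> xs \<longlonglongrightarrow> 0" if "x \<in> F" for x
    using B3 that by blast
  have "\<exists>x. \<forall>x0 \<Psi> e. finite \<Psi> \<and> (\<forall>g\<in>\<Psi>. bounded_linear g) \<and> 0 < e \<longrightarrow>
      (\<exists>n. \<forall>g\<in>\<Psi>. \<bar>g ((T ^^ n) x) - g x0\<bar> < (e::real))"
    by (rule weakly_dense_orbit[where T = T and F = F and \<iota> = \<iota> and V = V and M = "2 / d" and D = D,
          OF T_bounded F F_invariant \<iota>_add \<iota>_scale \<iota>_bound V_lin V_iso nofin V\<iota> bwd D])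
  then obtain x where x: "\<forall>x0 \<Psi> e. finite \<Psi> \<and> (\<forall>g\<in>\<Psi>. bounded_linear g) \<and> 0 < e \<longrightarrow>
      (\<exists>n. \<forall>g\<in>\<Psi>. \<bar>g ((T ^^ n) x) - g x0\<bar> < (e::real))" ..
  have "\<exists>a\<in>orbit T x. \<forall>f\<in>\<Phi>. cmod (f a - f x0) < e"
    if fin: "finite \<Phi>" and \<Phi>: "\<And>f. f \<in> \<Phi> \<Longrightarrow> K_functional cplx J f" and e: "0 < e" for x0 \<Phi> e
  proof -
    let ?\<Psi> = "(\<lambda>f x. Re (f x)) ` \<Phi> \<union> (\<lambda>f x. Im (f x)) ` \<Phi>"
    \<comment> \<open>Real and imaginary parts each get half of the tolerance, since the modulus is
      at most the sum of their absolute values.\<close>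
    have "\<exists>n. \<forall>g\<in>?\<Psi>. \<bar>g ((T ^^ n) x) - g x0\<bar> < e / 2"
      using fin e \<Phi> by (intro x[THEN spec, THEN spec, THEN spec, THEN mp]) (auto intro: K_functional_bounded_linear)
    then obtain n where n: "\<forall>g\<in>?\<Psi>. \<bar>g ((T ^^ n) x) - g x0\<bar> < e / 2" ..
    have "cmod (f ((T ^^ n) x) - f x0) < e" if f: "f \<in> \<Phi>" for f
      using bspec[OF n, of "\<lambda>x. Re (f x)"] bspec[OF n, of "\<lambda>x. Im (f x)"] f cmod_le[of "f ((T ^^ n) x) - f x0"] by simp
    then show ?thesis unfolding orbit_def by blast
  qed
  then show ?thesis unfolding weakly_hypercyclic_def weakly_dense_def by blast
qed

end
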